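(* Let $\mathbf{A}$ be a non-unital separable $\mathrm{C}^*$-algebra and let $\mathbf{A}^\#$ be a computable presentation of $\mathbf{A}$. Then there is an effective approximate unit of $\mathbf{A}^\#$.
   Context: A presentation $\mathbf{A}^\#$ of a (separable) $\mathrm{C}^*$-algebra $\mathbf{A}$ is $\mathbf{A}$ together with a finite or infinite sequence $(a_n)$ of elements of $\mathbf{A}$, called special points, that generate a dense $*$-subalgebra. The generated points of $\mathbf{A}^\#$ are the elements $p(a_0,\dots,a_m)$ with $p$ a rational $*$-polynomial (a noncommutative polynomial in $x_0,\dots,x_m,x_0^*,\dots,x_m^*$ with coefficients in $\mathbb{Q}(i)$ and no constant term); a code of a generated point is a natural-number code of such a $p$. $\mathbf{A}^\#$ is computable if from a code of a generated point $\rho$ and $k\in\mathbb{N}$ one can compute a rational $q$ with $|\,\|\rho\|-q\,|<2^{-k}$. A sequence $(x_n)_{n\in\mathbb{N}}$ of points of $\mathbf{A}$ is a computable sequence of $\mathbf{A}^\#$ if there is an algorithm which from $n$ and $k$ computes a code of a generated point $\rho$ with $\|x_n-\rho\|<2^{-k}$. A sequential approximate unit for $\mathbf{A}$ is a sequence $(u_n)_{n\in\mathbb{N}}$ of positive elements of $\mathbf{A}$ such that $\lim_n u_na=\lim_n au_n=a$ for every $a\in\mathbf{A}$. It is an effective approximate unit of $\mathbf{A}^\#$ if it is a computable sequence of $\mathbf{A}^\#$ and from a code of a generated point $a$ of $\mathbf{A}^\#$ it is possible to compute a modulus of convergence for $(u_na)_{n\in\mathbb{N}}$ and a modulus of convergence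 for $(au_n)_{n\in\mathbb{N}}$. A modulus of convergence for a sequence $(x_n)$ with limit $x$ is a function $g:\mathbb{N}\to\mathbb{N}$ such that $\|x_n-x\|<2^{-k}$ whenever $n\ge g(k)$. *)

theory Defs
  imports "HOL-Analysis.Analysis" "HOL-Library.Poly_Mapping" "HOL-Library.Extended_Nat"
    "HOL-Library.Nat_Bijection" "HOL-Library.Countable"
begin

section \<open>C*-algebras\<close>

text \<open>The class does not ask for a multiplicative unit. The C*-identity together with
  submultiplicativity makes the involution isometric.\<close>

class cstar_algebra = real_normed_algebra + complete_space +
  fixes scaleC :: "complex \<Rightarrow> 'a \<Rightarrow> 'a"  (infixr \<open>*\<^sub>C\<close> 75)
    and star :: "'a \<Rightarrow> 'a"
  assumes scaleC_add_right: "c *\<^sub>C (x + y) = c *\<^sub>C x + c *\<^sub>C y"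
    and scaleC_add_left: "(c + d) *\<^sub>C x = c *\<^sub>C x + d *\<^sub>C x"
    and scaleC_scaleC: "c *\<^sub>C d *\<^sub>C x = (c * d) *\<^sub>C x"
    and scaleR_scaleC: "r *\<^sub>R x = complex_of_real r *\<^sub>C x"
    and mult_scaleC_left: "(c *\<^sub>C x) * y = c *\<^sub>C (x * y)"
    and mult_scaleC_right: "x * (c *\<^sub>C y) = c *\<^sub>C (x * y)"
    and norm_scaleC: "norm (c *\<^sub>C x) = cmod c * norm x"
    and star_star: "star (star x) = x"
    and star_add: "star (x + y) = star x + star y"
    and star_mult: "star (x * y) = star y * star x"
    and star_scaleC: "star (c *\<^sub>C x) = cnj c *\<^sub>C star x"
    and cstar_identity: "norm (star x * x) = (norm x)\<^sup>2"

definition star_subalgebra :: "'a::cstar_algebra set \<Rightarrow> bool" where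
  "star_subalgebra B \<longleftrightarrow> 0 \<in> B \<and> (\<forall>x\<in>B. \<forall>y\<in>B. x + y \<in> B) \<and> (\<forall>c. \<forall>x\<in>B. c *\<^sub>C x \<in> B) \<and>
     (\<forall>x\<in>B. \<forall>y\<in>B. x * y \<in> B) \<and> (\<forall>x\<in>B. star x \<in> B)"

text \<open>The pair \<open>(x, c)\<close> stands for the element \<open>x + c 1\<close> of the unitization, whose unit
  is \<open>(0, 1)\<close>.\<close>

definition unitization_mult ::
    "'a::cstar_algebra \<times> complex \<Rightarrow> 'a \<times> complex \<Rightarrow> 'a \<times> complex" where
  "unitization_mult = (\<lambda>(x, c) (y, d). (x * y + d *\<^sub>C x + c *\<^sub>C y, c * d))"

text \<open>The spectrum is taken in the unitization, as is usual for an algebra without a unit.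
  (For an algebra with a unit this may add the point 0, which is irrelevant for positivity.)\<close>

definition spectrum :: "'a::cstar_algebra \<Rightarrow> complex set" where
  "spectrum x = {c. \<not> (\<exists>z. unitization_mult (x, - c) z = (0, 1) \<and> unitization_mult z (x, - c) = (0, 1))}"

definition positive :: "'a::cstar_algebra \<Rightarrow> bool" where
  "positive x \<longleftrightarrow> star x = x \<and> spectrum x \<subseteq> complex_of_real ` {0..}"

definition approximate_unit :: "(nat \<Rightarrow> 'a::cstar_algebra) \<Rightarrow> bool" where
  "approximate_unit u \<longleftrightarrow> (\<forall>n. positive (u n)) \<and>
     (\<forall>a. (\<lambda>n. u n * a) \<longlonglongrightarrow> a \<and> (\<lambda>n. a * u n) \<longlonglongrightarrow> a)"

definition modulus_of_convergence :: "(nat \<Rightarrow> 'a::real_normed_vector) \<Rightarrow> (nat \<Rightarrow> nat) \<Rightarrow> bool" where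
  "modulus_of_convergence X g \<longleftrightarrow>
     (\<exists>L. X \<longlonglongrightarrow> L \<and> (\<forall>k. \<forall>n\<ge>g k. norm (X n - L) < 1 / 2 ^ k))"

section \<open>Computable functions\<close>

text \<open>The general recursive (that is, total computable) functions of \<open>n\<close> arguments, as
  functions on argument lists. Only the values on lists of length \<open>n\<close> are meaningful. The
  rule \<open>mu\<close> is restricted to regular functions, so everything stays total; by Kleene's
  normal form theorem this yields all total computable functions.\<close>

inductive recursive :: "nat \<Rightarrow> (nat list \<Rightarrow> nat) \<Rightarrow> bool" where
  zero: "recursive n (\<lambda>xs. 0)"
| succ: "recursive 1 (\<lambda>xs. Suc (xs ! 0))"
| proj: "i < n \<Longrightarrow> recursive n (\<lambda>xs. xs ! i)"
| comp: "recursive (length gs) f \<Longrightarrow> (\<forall>g\<in>set gs. recursive n g) \<Longrightarrow>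
    recursive n (\<lambda>xs. f (map (\<lambda>g. g xs) gs))"
| prec: "recursive n f \<Longrightarrow> recursive (Suc (Suc n)) g \<Longrightarrow>
    recursive (Suc n) (\<lambda>xs. rec_nat (f (tl xs)) (\<lambda>y r. g (y # r # tl xs)) (hd xs))"
| mu: "recursive (Suc n) f \<Longrightarrow> (\<forall>xs. length xs = n \<longrightarrow> (\<exists>y. f (y # xs) = 0)) \<Longrightarrow>
    recursive n (\<lambda>xs. LEAST y. f (y # xs) = 0)"
| ext: "recursive n f \<Longrightarrow> (\<forall>xs. length xs = n \<longrightarrow> g xs = f xs) \<Longrightarrow> recursive n g"

section \<open>Rational *-polynomials and their codes\<close>

datatype letter = Var nat | VarStar nat

fun letter_index :: "letter \<Rightarrow> nat" where
  "letter_index (Var i) = i"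
| "letter_index (VarStar i) = i"

text \<open>A noncommutative *-polynomial assigns a coefficient to each word in the letters
  \<open>x\<^sub>i\<close>, \<open>x\<^sub>i\<^sup>*\<close>; the empty word carries the constant term.\<close>

type_synonym star_poly = "letter list \<Rightarrow>\<^sub>0 complex"

definition rational_star_poly :: "star_poly \<Rightarrow> bool" where
  "rational_star_poly p \<longleftrightarrow> Poly_Mapping.lookup p [] = 0 \<and>
     (\<forall>w. Re (Poly_Mapping.lookup p w) \<in> \<rat> \<and> Im (Poly_Mapping.lookup p w) \<in> \<rat>)"

definition poly_vars :: "star_poly \<Rightarrow> nat set" where
  "poly_vars p = (\<Union>w\<in>Poly_Mapping.keys p. letter_index ` set w)"

fun eval_letter :: "(nat \<Rightarrow> 'a::cstar_algebra) \<Rightarrow> letter \<Rightarrow> 'a" where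
  "eval_letter a (Var i) = a i"
| "eval_letter a (VarStar i) = star (a i)"

text \<open>The value at the empty word is a dummy: rational *-polynomials have no constant term.\<close>

fun eval_word :: "(nat \<Rightarrow> 'a::cstar_algebra) \<Rightarrow> letter list \<Rightarrow> 'a" where
  "eval_word a [] = 0"
| "eval_word a [l] = eval_letter a l"
| "eval_word a (l # l' # w) = eval_letter a l * eval_word a (l' # w)"

definition eval_poly :: "(nat \<Rightarrow> 'a::cstar_algebra) \<Rightarrow> star_poly \<Rightarrow> 'a" where
  "eval_poly a p = (\<Sum>w\<in>Poly_Mapping.keys p. Poly_Mapping.lookup p w *\<^sub>C eval_word a w)"

definition letter_decode :: "nat \<Rightarrow> letter" where
  "letter_decode n = (case sum_decode n of Inl i \<Rightarrow> Var i | Inr i \<Rightarrow> VarStar i)"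

definition coeff_decode :: "nat \<Rightarrow> complex" where
  "coeff_decode n = (case prod_decode n of (r, s) \<Rightarrow>
     Complex (real_of_rat (nat_to_rat_surj r)) (real_of_rat (nat_to_rat_surj s)))"

definition monomial_decode :: "nat \<Rightarrow> star_poly" where
  "monomial_decode n = (case prod_decode n of (c, w) \<Rightarrow>
     Poly_Mapping.single (map letter_decode (list_decode w)) (coeff_decode c))"

text \<open>A number codes a list of monomials and thereby their sum. Every rational *-polynomial
  has (many) codes, see \<open>rational_star_poly_has_code\<close>.\<close>

definition poly_decode :: "nat \<Rightarrow> star_poly" where
  "poly_decode n = sum_list (map monomial_decode (list_decode n))"

lemma rational_star_poly_has_code:
  assumes "rational_star_poly p"
  shows "\<exists>n. poly_decode n = p"
proof -
  have L: "\<exists>n. letter_decode n = l" for l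
  proof (cases l)
    case (Var i)
    then show ?thesis
      by (intro exI[of _ "sum_encode (Inl i)"]) (simp add: letter_decode_def)
  next
    case (VarStar i)
    then show ?thesis
      by (intro exI[of _ "sum_encode (Inr i)"]) (simp add: letter_decode_def)
  qed
  then obtain le where le: "\<And>l. letter_decode (le l) = l" by metis
  have W: "\<exists>n. map letter_decode (list_decode n) = w" for w
    by (intro exI[of _ "list_encode (map le w)"]) (simp add: le o_def)
  have C: "\<exists>n. coeff_decode n = c" if "Re c \<in> \<rat>" "Im c \<in> \<rat>" for c
  proof -
    from that obtain q r where qr: "Re c = real_of_rat q" "Im c = real_of_rat r"
      by (auto elim!: Rats_cases)
    obtain m n where "nat_to_rat_surj m = q" "nat_to_rat_surj n = r"
      using surj_nat_to_rat_surj by (metis surjD)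
    then show ?thesis
      by (intro exI[of _ "prod_encode (m, n)"]) (simp add: coeff_decode_def complex_eq_iff qr)
  qed
  have M: "\<exists>n. monomial_decode n = Poly_Mapping.single w c" if c: "Re c \<in> \<rat>" "Im c \<in> \<rat>" for w c
  proof -
    obtain m n where "coeff_decode m = c" "map letter_decode (list_decode n) = w"
      using C[OF c] W by blast
    then show ?thesis
      by (intro exI[of _ "prod_encode (m, n)"]) (simp add: monomial_decode_def)
  qed
  obtain ws where ws: "set ws = Poly_Mapping.keys p" "distinct ws"
    using finite_distinct_list[of "Poly_Mapping.keys p"] by auto
  have "\<exists>n. monomial_decode n = Poly_Mapping.single w (Poly_Mapping.lookup p w)" for w
    using assms by (intro M) (auto simp: rational_star_poly_def)
  then obtain m where m: "\<And>w. monomial_decode (m w) = Poly_Mapping.single w (Poly_Mapping.lookup p w)"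
    by metis
  have "poly_decode (list_encode (map m ws)) =
      (\<Sum>w\<leftarrow>ws. Poly_Mapping.single w (Poly_Mapping.lookup p w))"
    by (simp add: poly_decode_def m o_def)
  also have "\<dots> = (\<Sum>w\<in>Poly_Mapping.keys p. Poly_Mapping.single w (Poly_Mapping.lookup p w))"
    by (simp add: sum_list_distinct_conv_sum_set[OF ws(2)] ws(1))
  also have "\<dots> = p"
    by (rule poly_mapping_eqI) (simp add: lookup_sum lookup_single when_def in_keys_iff)
  finally show ?thesis by blast
qed

section \<open>Presentations\<close>

text \<open>The special points are \<open>special P n\<close> for \<open>enat n < num_special P\<close>; later values of
  \<open>special P\<close> are ignored, and \<open>num_special P = \<infinity>\<close> is an infinite sequence.\<close>

record 'a presentation =
  num_special :: enat
  special :: "nat \<Rightarrow> 'a"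

definition is_presentation :: "'a::cstar_algebra presentation \<Rightarrow> bool" where
  "is_presentation P \<longleftrightarrow>
     closure (star_subalgebra hull {special P n | n. enat n < num_special P}) = UNIV"

definition is_code :: "'a::cstar_algebra presentation \<Rightarrow> nat \<Rightarrow> bool" where
  "is_code P e \<longleftrightarrow> rational_star_poly (poly_decode e) \<and>
     (\<forall>i\<in>poly_vars (poly_decode e). enat i < num_special P)"

definition generated_point :: "'a::cstar_algebra presentation \<Rightarrow> nat \<Rightarrow> 'a" where
  "generated_point P e = eval_poly (special P) (poly_decode e)"

definition computable_presentation :: "'a::cstar_algebra presentation \<Rightarrow> bool" where
  "computable_presentation P \<longleftrightarrow> is_presentation P \<and>
     (\<exists>f. recursive 2 f \<and> (\<forall>e k. is_code P e \<longrightarrow>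
        \<bar>norm (generated_point P e) - real_of_rat (nat_to_rat_surj (f [e, k]))\<bar> < 1 / 2 ^ k))"

definition computable_sequence ::
    "'a::cstar_algebra presentation \<Rightarrow> (nat \<Rightarrow> 'a) \<Rightarrow> bool" where
  "computable_sequence P x \<longleftrightarrow> (\<exists>f. recursive 2 f \<and>
     (\<forall>n k. is_code P (f [n, k]) \<and> norm (x n - generated_point P (f [n, k])) < 1 / 2 ^ k))"

definition effective_approximate_unit ::
    "'a::cstar_algebra presentation \<Rightarrow> (nat \<Rightarrow> 'a) \<Rightarrow> bool" where
  "effective_approximate_unit P u \<longleftrightarrow> approximate_unit u \<and> computable_sequence P u \<and>
     (\<exists>g. recursive 2 g \<and> (\<forall>e. is_code P e \<longrightarrow>
        modulus_of_convergence (\<lambda>n. u n * generated_point P e) (\<lambda>k. g [e, k]))) \<and>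
     (\<exists>h. recursive 2 h \<and> (\<forall>e. is_code P e \<longrightarrow>
        modulus_of_convergence (\<lambda>n. generated_point P e * u n) (\<lambda>k. h [e, k])))"

end

theory Submission
  imports Defs
begin

text \<open>
An effective approximate unit is found by brute-force search. Number the generated points by codes
\<open>e\<close>. At stage \<open>n\<close>, search for a self-adjoint generated point \<open>h\<close> of norm below 5 with
\<open>norm (h\<^sup>2 a - a) < 1 / 2 ^ n\<close> and \<open>norm (a h\<^sup>2 - a) < 1 / 2 ^ n\<close> for the generated points \<open>a\<close> with
codes \<open>e \<le> n\<close>, and put \<open>u n = h\<^sup>2\<close>. Norms of generated points are computable, so strict upper bounds
on them can be confirmed by a computation, and \<open>u\<close> is a computable sequence as soon as the search always
succeeds. By construction \<open>e + k\<close> is a modulus of convergence for the point with code \<open>e\<close>; convergence at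
the other points of the algebra follows from density and from the bound 25 on the norms of the \<open>u n\<close>.
Three things have to be shown.

\<^item> The squares \<open>h\<^sup>2\<close> are positive (\<open>positive_square\<close>). For \<open>c = d\<^sup>2\<close> with \<open>d\<close> not real one needs the
  inverses of \<open>1 - h / d\<close> and \<open>1 + h / d\<close>. Elements \<open>x\<close> of this kind satisfy \<open>star x = \<omega> x\<close> with a complex number
  \<open>\<omega> \<noteq> 1\<close> of modulus 1. A Cayley transform is unitary for them and bounds all existing quasi-inverses of
  real multiples of \<open>x\<close> by one constant; continuation along these multiples then reaches \<open>x\<close>
  (\<open>quasi_inverse_exists\<close>). No functional calculus is involved.

\<^item> The search succeeds (\<open>self_adjoint_approximate_unit\<close>, transferred to generated points by
  \<open>good_codes_dense\<close>). The inverse of \<open>1 - (\<i> / \<epsilon>) h\<close> is a contraction that is small on \<open>h\<close>. Products of such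
  contractions are small on any given finite set, and \<open>T\<^sup>* T\<close> makes them self-adjoint.

\<^item> The test is recursive (\<open>recursive_search_defect\<close>). Sums, products and adjoints of
  *-polynomials are loops over coded lists of monomials, and \<open>sanitize\<close> turns an arbitrary number into
  the code of a generated point without changing the value of numbers that are codes already.
\<close>

section \<open>Involution and complex scaling\<close>

lemma star_zero [simp]: "star (0::'a::cstar_algebra) = 0"
  using star_add[of "0::'a" 0] by simp

lemma star_minus: "star (- x) = - star (x::'a::cstar_algebra)"
  using star_add[of x "- x"] by (simp add: eq_neg_iff_add_eq_0 add.commute)

lemma star_diff: "star (x - y) = star x - star (y::'a::cstar_algebra)"
  using star_add[of x "- y"] by (simp add: star_minus)

lemma scaleC_zero_left [simp]: "0 *\<^sub>C x = (0::'a::cstar_algebra)"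
  using scaleR_scaleC[of 0 x] by simp

lemma scaleC_one [simp]: "1 *\<^sub>C x = (x::'a::cstar_algebra)"
  using scaleR_scaleC[of 1 x] by simp

lemma scaleC_minus_left: "(- c) *\<^sub>C x = - (c *\<^sub>C (x::'a::cstar_algebra))"
  using scaleC_add_left[of c "- c" x] by (simp add: eq_neg_iff_add_eq_0 add.commute)

lemma scaleC_zero_right [simp]: "c *\<^sub>C 0 = (0::'a::cstar_algebra)"
  using scaleC_add_right[of c "0::'a" 0] by simp

lemma scaleC_minus_right: "c *\<^sub>C (- x) = - (c *\<^sub>C (x::'a::cstar_algebra))"
  using scaleC_add_right[of c "- x" x] by (simp add: eq_neg_iff_add_eq_0)

lemma scaleC_diff_right: "c *\<^sub>C (x - y) = c *\<^sub>C x - c *\<^sub>C (y::'a::cstar_algebra)"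
  using scaleC_add_right[of c x "- y"] by (simp add: scaleC_minus_right)

lemma scaleC_diff_left: "(c - d) *\<^sub>C x = c *\<^sub>C x - d *\<^sub>C (x::'a::cstar_algebra)"
  using scaleC_add_left[of c "- d" x] by (simp add: scaleC_minus_left)

lemma norm_star [simp]: "norm (star x) = norm (x::'a::cstar_algebra)"
proof -
  have le: "norm y \<le> norm (star y)" for y :: 'a
  proof (cases "y = 0")
    case False
    have "norm y * norm y \<le> norm (star y) * norm y"
      using cstar_identity[of y] norm_mult_ineq[of "star y" y] by (simp add: power2_eq_square)
    with False show ?thesis by simp
  qed simp
  show ?thesis using le[of x] le[of "star x"] by (simp add: star_star)
qed

lemma norm_mult_star: "norm (x * star x) = (norm (x::'a::cstar_algebra))\<^sup>2"
  using cstar_identity[of "star x"] by (simp add: star_star)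

text \<open>Testing left multiplication by \<open>x\<close> on \<open>star x\<close> recovers \<open>norm x\<close>. This lets all norm estimates
for \<open>1 + y\<close> in the unitization be made on \<open>a + y * a\<close> in the algebra, without a norm on the
unitization.\<close>

lemma norm_le_left_multiplier:
  fixes x :: "'a::cstar_algebra"
  assumes "\<And>a. norm (x * a) \<le> c * norm a" and "0 \<le> c"
  shows "norm x \<le> c"
proof (cases "x = 0")
  case False
  have "norm x * norm x \<le> c * norm x"
    using assms(1)[of "star x"] by (simp add: norm_mult_star power2_eq_square)
  with False show ?thesis by simp
qed (use assms(2) in simp)

section \<open>Quasi-inverses and positivity of squares\<close>

text \<open>In the unitization this says that \<open>1 + y\<close> is the two-sided inverse of \<open>1 - x\<close>.\<close>

definition quasi_inverse :: "'a::cstar_algebra \<Rightarrow> 'a \<Rightarrow> bool" where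
  "quasi_inverse x y \<longleftrightarrow> x * y = y - x \<and> y * x = y - x"

text \<open>Both expressions are read off from \<open>(1 - x) (1 - z) = 1 - (x + z - x z)\<close> and from the product
\<open>(1 + w) (1 + y)\<close> of the inverses in reverse order.\<close>

lemma quasi_inverse_compose:
  assumes "quasi_inverse x y" and "quasi_inverse z w"
  shows "quasi_inverse (x + z - x * z) (w + y + w * y)"
proof -
  have e: "x * y = y - x" "y * x = y - x" "z * w = w - z" "w * z = w - z"
    using assms by (auto simp: quasi_inverse_def)
  have e': "x * (y * t) = y * t - x * t" "y * (x * t) = y * t - x * t"
    "z * (w * t) = w * t - z * t" "w * (z * t) = w * t - z * t" for t
    using e by (metis mult.assoc left_diff_distrib)+
  show ?thesis
    unfolding quasi_inverse_def by (simp add: e e' algebra_simps)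
qed

text \<open>The Neumann series: its sum is the fixed point of the contraction \<open>y \<mapsto> x + x y\<close>. The left and the
right fixed point agree, because \<open>z x = z (y - x y) = (z - z x) y = x y\<close>.\<close>

lemma quasi_inverse_if_norm_less_1:
  fixes x :: "'a::cstar_algebra"
  assumes "norm x < 1"
  shows "\<exists>y. quasi_inverse x y"
proof -
  have "\<exists>!y. x + x * y = y"
  proof (rule banach_fix_type)
    show "\<forall>a b. dist (x + x * a) (x + x * b) \<le> norm x * dist a b"
      by (simp add: dist_norm norm_mult_ineq flip: right_diff_distrib)
  qed (use assms in simp_all)
  then obtain y where y: "x + x * y = y" by blast
  have "\<exists>!y. x + y * x = y"
  proof (rule banach_fix_type)
    show "\<forall>a b. dist (x + a * x) (x + b * x) \<le> norm x * dist a b"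
      by (simp add: dist_norm norm_mult_ineq mult.commute[of "norm x"] flip: left_diff_distrib)
  qed (use assms in simp_all)
  then obtain z where z: "x + z * x = z" by blast
  have "z * (x * y) = z * y - z * x" "(z * x) * y = z * y - x * y"
    using y z by (metis add_diff_cancel_left' right_diff_distrib, metis add_diff_cancel_left' left_diff_distrib)
  then have "z * x = x * y" by (simp add: mult.assoc)
  then have "y = z" using y z by simp
  then show ?thesis
    using y z by (intro exI[of _ y]) (simp add: quasi_inverse_def eq_diff_eq add.commute)
qed

text \<open>The Cayley transform. With \<open>star x = \<omega> x\<close> the elements \<open>x\<close> and \<open>star x\<close> commute, so that
\<open>(1 - star x) (1 - x)\<^sup>-\<^sup>1\<close> is unitary, and this element is \<open>1 + (1 - \<omega>) y\<close>.\<close>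

lemma norm_cayley:
  fixes x y a :: "'a::cstar_algebra"
  assumes x: "star x = \<omega> *\<^sub>C x" and \<omega>: "cmod \<omega> = 1" and q: "quasi_inverse x y"
  shows "norm (a + (1 - \<omega>) *\<^sub>C (y * a)) = norm a"
proof -
  define k where "k = 1 - \<omega>"
  define s where "s = star y"
  have ww: "cnj \<omega> * \<omega> = 1"
    using \<omega> by (metis complex_norm_square mult.commute of_real_1 power_one)
  have xy: "x * y = y - x" using q by (simp add: quasi_inverse_def)
  have "star (x * y) = star (y - x)" by (simp add: xy)
  then have "\<omega> *\<^sub>C (s * x) = s - \<omega> *\<^sub>C x"
    by (simp add: star_mult star_diff x s_def mult_scaleC_right)
  then have "cnj \<omega> *\<^sub>C \<omega> *\<^sub>C (s * x) = cnj \<omega> *\<^sub>C (s - \<omega> *\<^sub>C x)" by simp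
  then have sx: "s * x = cnj \<omega> *\<^sub>C s - x"
    by (simp add: scaleC_scaleC ww scaleC_diff_right)
  have "s * y = s * (x + x * y)" by (simp add: xy)
  also have "\<dots> = s * x + (s * x) * y" by (simp add: algebra_simps)
  also have "\<dots> = cnj \<omega> *\<^sub>C s + cnj \<omega> *\<^sub>C (s * y) - y"
    by (simp add: sx algebra_simps mult_scaleC_left xy)
  finally have A: "cnj k *\<^sub>C (s * y) = cnj \<omega> *\<^sub>C s - y"
    by (simp add: k_def scaleC_diff_left algebra_simps)
  have "star (cnj k *\<^sub>C (s * y)) = star (cnj \<omega> *\<^sub>C s - y)" by (simp only: A)
  then have B: "k *\<^sub>C (s * y) = \<omega> *\<^sub>C y - s"
    by (simp add: star_scaleC star_mult star_diff star_star s_def)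
  \<comment> \<open>\<open>Z\<close> is unitarity of \<open>1 + k y\<close>, written without the unit.\<close>
  have kk: "cnj k * k = k + cnj k"
    using ww by (simp add: k_def algebra_simps)
  have Z: "k *\<^sub>C y + cnj k *\<^sub>C s + (cnj k * k) *\<^sub>C (s * y) = 0"
    by (simp add: kk scaleC_add_left A B) (simp add: k_def scaleC_diff_left)
  have "star (a + k *\<^sub>C (y * a)) * (a + k *\<^sub>C (y * a))
      = star a * a + star a * ((k *\<^sub>C y + cnj k *\<^sub>C s + (cnj k * k) *\<^sub>C (s * y)) * a)"
    by (simp add: star_add star_scaleC star_mult s_def algebra_simps mult_scaleC_left
        mult_scaleC_right scaleC_scaleC scaleC_add_right)
  then have "(norm (a + k *\<^sub>C (y * a)))\<^sup>2 = (norm a)\<^sup>2"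
    by (simp add: Z flip: cstar_identity)
  then show ?thesis by (simp add: k_def)
qed

lemma norm_quasi_inverse_le:
  fixes x y :: "'a::cstar_algebra"
  assumes x: "star x = \<omega> *\<^sub>C x" and \<omega>: "cmod \<omega> = 1" "\<omega> \<noteq> 1" and q: "quasi_inverse x y"
  shows "norm y \<le> 2 / cmod (1 - \<omega>)"
proof (rule norm_le_left_multiplier)
  fix a
  have "norm ((1 - \<omega>) *\<^sub>C (y * a)) \<le> norm (a + (1 - \<omega>) *\<^sub>C (y * a)) + norm a"
    by (metis add_diff_cancel_left' norm_triangle_ineq4)
  also have "\<dots> = 2 * norm a" using norm_cayley[OF x \<omega>(1) q] by simp
  finally show "norm (y * a) \<le> 2 / cmod (1 - \<omega>) * norm a"
    using \<omega>(2) by (simp add: norm_scaleC field_simps)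
qed simp

text \<open>The Cayley transform bounds every quasi-inverse \<open>y\<close> of \<open>x\<close> by a constant that depends on \<open>\<omega>\<close> only.
Since \<open>1 - s x = (1 - x) (1 - (s - 1) y)\<close>, invertibility therefore passes from \<open>x\<close> to \<open>s x\<close> for one
factor \<open>s > 1\<close> that is the same at every scale, and finitely many such steps lead from an element of
norm below 1 to any \<open>x\<close>. This takes the place of the theorem that self-adjoint elements have real
spectrum: the hypothesis holds for \<open>h / d\<close> with \<open>h\<close> self-adjoint and \<open>d\<close> not real.\<close>

lemma quasi_inverse_exists:
  fixes x :: "'a::cstar_algebra"
  assumes x: "star x = \<omega> *\<^sub>C x" and \<omega>: "cmod \<omega> = 1" "\<omega> \<noteq> 1"
  shows "\<exists>y. quasi_inverse x y"
proof -
  \<comment> \<open>\<open>1 / \<delta>\<close> bounds the quasi-inverses; with \<open>s - 1 = \<delta> / 2\<close>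
    the correction \<open>(s - 1) y\<close> has norm below 1.\<close>
  define \<delta> where "\<delta> = cmod (1 - \<omega>) / 2"
  define s where "s = 1 + \<delta> / 2"
  have \<delta>: "\<delta> > 0" using \<omega>(2) by (simp add: \<delta>_def)
  then have s: "s > 1" by (simp add: s_def)
  have "star z = \<omega> *\<^sub>C z \<Longrightarrow> norm z < s ^ m \<Longrightarrow> \<exists>y. quasi_inverse z y" for m and z :: 'a
  proof (induction m arbitrary: z)
    case 0
    then show ?case by (simp add: quasi_inverse_if_norm_less_1)
  next
    case (Suc m)
    define z' where "z' = (1 / s) *\<^sub>R z"
    have sz': "star z' = \<omega> *\<^sub>C z'"
      by (simp add: z'_def scaleR_scaleC star_scaleC Suc.prems(1) scaleC_scaleC mult.commute)
    moreover have "norm z' < s ^ m"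
      using Suc.prems(2) s by (simp add: z'_def field_simps)
    ultimately obtain y where y: "quasi_inverse z' y" using Suc.IH by blast
    have "norm y \<le> 1 / \<delta>"
      using norm_quasi_inverse_le[OF sz' \<omega> y] by (simp add: \<delta>_def)
    then have "norm ((s - 1) *\<^sub>R y) \<le> 1 / 2"
      using \<delta> by (simp add: s_def field_simps)
    then obtain w where "quasi_inverse ((s - 1) *\<^sub>R y) w"
      using quasi_inverse_if_norm_less_1[of "(s - 1) *\<^sub>R y"] by auto
    with y have "\<exists>v. quasi_inverse (z' + (s - 1) *\<^sub>R y - z' * ((s - 1) *\<^sub>R y)) v"
      using quasi_inverse_compose by blast
    moreover have "z' + (s - 1) *\<^sub>R y - z' * ((s - 1) *\<^sub>R y) = s *\<^sub>R z'"
      using y by (simp add: quasi_inverse_def scaleR_diff_right scaleR_diff_left right_diff_distrib)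
    moreover have "s *\<^sub>R z' = z" using s by (simp add: z'_def)
    ultimately show ?case by simp
  qed
  moreover obtain m where "norm x < s ^ m" using real_arch_pow[OF s] by blast
  ultimately show ?thesis using x by blast
qed

text \<open>If \<open>c\<close> is not in \<open>[0, \<infinity>)\<close> then \<open>c = d\<^sup>2\<close> with \<open>d\<close> not real, and \<open>h\<^sup>2 - c\<close> is \<open>- c\<close> times
\<open>(1 - h / d) (1 + h / d)\<close>, a product of two invertible factors.\<close>

lemma positive_square:
  fixes h :: "'a::cstar_algebra"
  assumes h: "star h = h"
  shows "positive (h * h)"
  unfolding positive_def
proof (intro conjI subsetI)
  show "star (h * h) = h * h" by (simp add: star_mult h)
  fix c assume c: "c \<in> spectrum (h * h)"
  show "c \<in> complex_of_real ` {0..}"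
  proof (rule ccontr)
    assume nc: "c \<notin> complex_of_real ` {0..}"
    define d where "d = csqrt c"
    have dd: "d * d = c" using power2_csqrt[of c] by (simp add: d_def power2_eq_square)
    have c0: "c \<noteq> 0" using nc by (metis atLeast_iff image_eqI of_real_0 order_refl)
    then have d0: "d \<noteq> 0" using dd by auto
    have "cnj d \<noteq> d"
    proof
      assume "cnj d = d"
      then obtain r where "d = complex_of_real r" by (metis Reals_cases Reals_cnj_iff)
      then have "c = complex_of_real (r * r)" using dd by simp
      then show False using nc by (metis atLeast_iff image_eqI zero_le_square)
    qed
    then have \<omega>: "cmod (d / cnj d) = 1" "d / cnj d \<noteq> 1"
      using d0 by (auto simp: norm_divide)
    define x where "x = (1 / d) *\<^sub>C h"
    have sx: "star x = (d / cnj d) *\<^sub>C x" "star (- x) = (d / cnj d) *\<^sub>C (- x)"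
      using d0 by (simp_all add: x_def star_scaleC h scaleC_scaleC star_minus scaleC_minus_right)
    obtain y w where "quasi_inverse x y" "quasi_inverse (- x) w"
      using quasi_inverse_exists[OF sx(1) \<omega>] quasi_inverse_exists[OF sx(2) \<omega>] by blast
    then obtain v where "quasi_inverse (x + - x - x * (- x)) v"
      using quasi_inverse_compose by blast
    then have v: "quasi_inverse ((1 / c) *\<^sub>C (h * h)) v"
      by (simp add: x_def mult_scaleC_left mult_scaleC_right scaleC_scaleC dd)
    have e: "(1 / c) *\<^sub>C (h * (h * v)) = v - (1 / c) *\<^sub>C (h * h)"
      "(1 / c) *\<^sub>C (v * (h * h)) = v - (1 / c) *\<^sub>C (h * h)"
      using v by (simp_all add: quasi_inverse_def mult_scaleC_left mult_scaleC_right mult.assoc)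
    have "unitization_mult (h * h, - c) ((- 1 / c) *\<^sub>C v, - 1 / c) = (0, 1)"
      "unitization_mult ((- 1 / c) *\<^sub>C v, - 1 / c) (h * h, - c) = (0, 1)"
      using c0 by (simp_all add: unitization_mult_def mult_scaleC_left mult_scaleC_right
          scaleC_scaleC scaleC_minus_left scaleC_minus_right e mult.assoc)
    then show False using c unfolding spectrum_def by blast
  qed
qed

section \<open>Self-adjoint approximate units\<close>

definition complement_contractive :: "'a::cstar_algebra \<Rightarrow> bool" where
  "complement_contractive v \<longleftrightarrow> (\<forall>a. norm (a - v * a) \<le> norm a)"

text \<open>Take \<open>1 - v = (1 - x)\<^sup>-\<^sup>1\<close> for the skew-adjoint element \<open>x = (\<i> / \<epsilon>) h\<close>. It is the mean of 1 and
the unitary Cayley transform of \<open>x\<close>, hence a contraction, and \<open>(1 - x)\<^sup>-\<^sup>1 x = y\<close> has norm at most 1,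
so that \<open>(1 - v) h\<close> has norm at most \<open>\<epsilon>\<close>.\<close>

lemma complement_contractive_self_adjoint:
  fixes h :: "'a::cstar_algebra"
  assumes h: "star h = h" and \<epsilon>: "\<epsilon> > 0"
  shows "\<exists>v. complement_contractive v \<and> norm (h - v * h) \<le> \<epsilon>"
proof -
  define c where "c = Complex 0 (1 / \<epsilon>)"
  have c: "cmod c = 1 / \<epsilon>" "cnj c = - c" using \<epsilon> by (simp_all add: c_def complex_eq_iff cmod_def)
  define x where "x = c *\<^sub>C h"
  have sx: "star x = (- 1) *\<^sub>C x"
    by (simp add: x_def star_scaleC h c(2) scaleC_scaleC)
  obtain y where y: "quasi_inverse x y" using quasi_inverse_exists[OF sx] by auto
  have cay: "norm (a + 2 *\<^sub>R (y * a)) = norm a" for a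
    using norm_cayley[OF sx _ y, of a] by (simp add: scaleR_scaleC)
  have "norm (a - (- y) * a) \<le> norm a" for a
  proof -
    have "a - (- y) * a = (1 / 2) *\<^sub>R (a + (a + 2 *\<^sub>R (y * a)))"
      by (simp add: algebra_simps flip: scaleR_2)
    then show ?thesis using norm_triangle_ineq[of a "a + 2 *\<^sub>R (y * a)"] cay[of a] by simp
  qed
  moreover have "norm (h - (- y) * h) \<le> \<epsilon>"
  proof -
    have "c *\<^sub>C (h + y * h) = y"
      using y by (simp add: quasi_inverse_def x_def scaleC_add_right mult_scaleC_right)
    then have "norm (h + y * h) = \<epsilon> * norm y"
      using c(1) \<epsilon> norm_scaleC[of c "h + y * h"] by (simp add: field_simps)
    moreover have "norm y \<le> 1" using norm_quasi_inverse_le[OF sx _ _ y] by simp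
    ultimately show ?thesis using \<epsilon> by simp
  qed
  ultimately show ?thesis unfolding complement_contractive_def by blast
qed

text \<open>Apply the self-adjoint case to \<open>r star r\<close>: for \<open>t = (1 - v) r\<close> the C*-identity bounds
\<open>(norm t)\<^sup>2\<close> by the norm of \<open>(1 - v) r star r\<close>.\<close>

lemma complement_contractive_element:
  fixes r :: "'a::cstar_algebra"
  assumes \<epsilon>: "\<epsilon> > 0"
  shows "\<exists>v. complement_contractive v \<and> norm (r - v * r) \<le> \<epsilon>"
proof -
  obtain v where v: "complement_contractive v" "norm (r * star r - v * (r * star r)) \<le> \<epsilon>\<^sup>2"
    using complement_contractive_self_adjoint[of "r * star r" "\<epsilon>\<^sup>2"] \<epsilon> by (auto simp: star_mult star_star)
  define t where "t = r - v * r"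
  have t: "t * a = r * a - v * (r * a)" for a by (simp add: t_def algebra_simps)
  have "(norm t)\<^sup>2 = norm (t * star t)" by (simp add: norm_mult_star)
  also have "\<dots> = norm (r * star t - v * (r * star t))" by (simp only: t)
  also have "\<dots> \<le> norm (r * star t)" using v(1) by (simp add: complement_contractive_def)
  also have "\<dots> = norm (star (r * star t))" by simp
  also have "star (r * star t) = r * star r - v * (r * star r)"
    by (simp add: star_mult star_star t)
  finally have "(norm t)\<^sup>2 \<le> \<epsilon>\<^sup>2" using v(2) by linarith
  then show ?thesis using v(1) \<epsilon> t_def by (metis less_imp_le power2_le_imp_le)
qed

text \<open>Complements multiply: \<open>1 - w = (1 - u) (1 - v)\<close> is again a contraction and stays small on whatever
\<open>1 - v\<close> is small on, so that elements can be treated one after the other. The upward directedness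
of the positive elements of norm below 1, the usual reason for approximate units, is thus avoided.\<close>

lemma complement_contractive_finite:
  fixes F :: "'a::cstar_algebra set"
  assumes "finite F" and \<epsilon>: "\<epsilon> > 0"
  shows "\<exists>v. complement_contractive v \<and> (\<forall>r\<in>F. norm (r - v * r) \<le> \<epsilon>)"
  using assms(1)
proof (induction F rule: finite_induct)
  case empty
  have "complement_contractive (0::'a)" by (simp add: complement_contractive_def)
  then show ?case by auto
next
  case (insert s F)
  then obtain v where v: "complement_contractive v" "\<forall>r\<in>F. norm (r - v * r) \<le> \<epsilon>" by blast
  obtain u where u: "complement_contractive u" "norm ((s - v * s) - u * (s - v * s)) \<le> \<epsilon>"
    using complement_contractive_element[OF \<epsilon>] by blast
  let ?w = "u + v - u * v"
  have w: "a - ?w * a = (a - v * a) - u * (a - v * a)" for a by (simp add: algebra_simps)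
  have le: "norm (a - ?w * a) \<le> norm (a - v * a)" for a
    unfolding w using u(1) by (simp add: complement_contractive_def)
  show ?case
  proof (intro exI[of _ ?w] conjI ballI)
    show "complement_contractive ?w" using le v(1) order_trans unfolding complement_contractive_def by blast
    fix r assume "r \<in> insert s F"
    then show "norm (r - ?w * r) \<le> \<epsilon>"
      using u(2) v(2) w[of s] le[of r] order_trans by (metis insert_iff)
  qed
qed

lemma norm_complement_star_le:
  fixes v a :: "'a::cstar_algebra"
  assumes "complement_contractive v"
  shows "norm (a - star v * a) \<le> norm a"
proof -
  define t where "t = a - star v * a"
  have "norm t * norm t = norm (star t * t)" by (simp add: cstar_identity power2_eq_square)
  also have "star t * t = star a * (t - v * t)"
    by (simp add: t_def star_diff star_mult star_star algebra_simps)
  also have "norm \<dots> \<le> norm a * norm (t - v * t)"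
    using norm_mult_ineq[of "star a" "t - v * t"] by simp
  also have "\<dots> \<le> norm a * norm t"
    using assms by (intro mult_left_mono) (simp_all add: complement_contractive_def)
  finally show ?thesis by (cases "t = 0") (simp_all add: t_def)
qed

text \<open>Replacing \<open>1 - v\<close> by \<open>1 - h = (1 - v)\<^sup>* (1 - v)\<close> makes \<open>h\<close> self-adjoint; smallness on the adjoints
of the elements of \<open>F\<close> then gives smallness of \<open>r (1 - h)\<close>, and
\<open>1 - h\<^sup>2 = (1 + h) (1 - h)\<close>.\<close>

lemma self_adjoint_approximate_unit:
  fixes F :: "'a::cstar_algebra set"
  assumes "finite F" and \<epsilon>: "\<epsilon> > 0"
  shows "\<exists>h. star h = h \<and> norm h \<le> 2 \<and> (\<forall>r\<in>F. norm (h * h * r - r) < \<epsilon> \<and> norm (r * (h * h) - r) < \<epsilon>)"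
proof -
  obtain v where v: "complement_contractive v" "\<forall>r\<in>F \<union> star ` F. norm (r - v * r) \<le> \<epsilon> / 4"
    using complement_contractive_finite[of "F \<union> star ` F" "\<epsilon> / 4"] assms by auto
  define h where "h = v + star v - star v * v"
  have sh: "star h = h" by (simp add: h_def star_add star_diff star_mult star_star add.commute)
  have ha: "a - h * a = (a - v * a) - star v * (a - v * a)" for a
    by (simp add: h_def algebra_simps)
  have le: "norm (a - h * a) \<le> norm (a - v * a)" for a
    unfolding ha by (rule norm_complement_star_le[OF v(1)])
  have le1: "norm (a - h * a) \<le> norm a" for a
    using le[of a] v(1) unfolding complement_contractive_def by (metis order_trans)
  have nh: "norm h \<le> 2"
  proof (rule norm_le_left_multiplier)
    fix a
    have "norm (h * a) = norm (a - (a - h * a))" by simp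
    also have "\<dots> \<le> norm a + norm (a - h * a)" by (rule norm_triangle_ineq4)
    finally show "norm (h * a) \<le> 2 * norm a" using le1[of a] by simp
  qed simp
  have small: "norm (h * h * r - r) < \<epsilon>" if "r \<in> F \<union> star ` F" for r
  proof -
    define t where "t = r - h * r"
    have t: "norm t \<le> \<epsilon> / 4" using le[of r] v(2) that order_trans unfolding t_def by blast
    have "h * h * r - r = - (t + h * t)" by (simp add: t_def algebra_simps)
    then have "norm (h * h * r - r) \<le> norm t + norm h * norm t"
      by (metis norm_minus_cancel norm_triangle_le add_left_mono norm_mult_ineq)
    also have "\<dots> \<le> norm t + 2 * norm t" using nh by (intro add_left_mono mult_right_mono) auto
    finally show ?thesis using t \<epsilon> by linarith
  qed
  have "norm (r * (h * h) - r) < \<epsilon>" if "r \<in> F" for r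
  proof -
    have "r * (h * h) - r = star (h * h * star r - star r)"
      by (simp add: star_diff star_mult star_star sh mult.assoc)
    then show ?thesis using small[of "star r"] that by simp
  qed
  then show ?thesis using sh nh small by blast
qed

section \<open>Closure properties of the recursive functions\<close>

named_theorems rec_intros

lemma recursive_cong: "recursive n f \<Longrightarrow> (\<And>xs. length xs = n \<Longrightarrow> g xs = f xs) \<Longrightarrow> recursive n g"
  using recursive.ext by blast

lemma recursive_comp1:
  assumes "recursive 1 (\<lambda>xs. g (xs ! 0))" "recursive n F"
  shows "recursive n (\<lambda>xs. g (F xs))"
  using recursive.comp[of "[F]" "\<lambda>xs. g (xs ! 0)" n] assms by simp

lemma recursive_comp2:
  assumes "recursive 2 (\<lambda>xs. g (xs ! 0) (xs ! 1))" "recursive n F" "recursive n G"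
  shows "recursive n (\<lambda>xs. g (F xs) (G xs))"
  using recursive.comp[of "[F, G]" "\<lambda>xs. g (xs ! 0) (xs ! 1)" n] assms by (simp add: numeral_2_eq_2)

lemma recursive_Suc [rec_intros]: "recursive n F \<Longrightarrow> recursive n (\<lambda>xs. Suc (F xs))"
  by (rule recursive_comp1[OF recursive.succ])

lemma recursive_const [rec_intros]: "recursive n (\<lambda>xs. c)"
  by (induction c) (auto intro: recursive.zero recursive_Suc)

lemma recursive_proj [rec_intros]: "i < n \<Longrightarrow> recursive n (\<lambda>xs. xs ! i)"
  by (rule recursive.proj)

text \<open>The basic rule recurses on the first argument and passes the others on as parameters. Composing it with
projections frees the number of iterations from being an argument.\<close>

lemma recursive_rec_nat:
  assumes "recursive n N" "recursive n A" "recursive (n + 2) G"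
  shows "recursive n (\<lambda>xs. rec_nat (A xs) (\<lambda>y r. G (y # r # xs)) (N xs))"
proof -
  let ?f = "\<lambda>xs. rec_nat (A (tl xs)) (\<lambda>y r. G (y # r # tl xs)) (hd xs)"
  let ?gs = "N # map (\<lambda>i xs. xs ! i) [0..<n]"
  have "recursive (Suc n) ?f"
    using assms by (intro recursive.prec) auto
  then have "recursive n (\<lambda>xs. ?f (map (\<lambda>h. h xs) ?gs))"
    by (intro recursive.comp) (use assms in \<open>auto intro: recursive.proj\<close>)
  then show ?thesis
  proof (rule recursive_cong)
    fix xs :: "nat list" assume "length xs = n"
    then show "rec_nat (A xs) (\<lambda>y r. G (y # r # xs)) (N xs) = ?f (map (\<lambda>h. h xs) ?gs)"
      using map_nth[of xs] by (simp add: o_def)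
  qed
qed

lemma recursive_add [rec_intros]:
  assumes "recursive n F" "recursive n G" shows "recursive n (\<lambda>xs. F xs + G xs)"
proof -
  have "recursive n (\<lambda>xs. rec_nat (F xs) (\<lambda>y r. (\<lambda>ys. Suc (ys ! 1)) (y # r # xs)) (G xs))"
    by (intro recursive_rec_nat assms rec_intros) simp
  moreover have "rec_nat a (\<lambda>y r. Suc r) b = a + b" for a b by (induction b) auto
  ultimately show ?thesis by simp
qed

lemma recursive_pred [rec_intros]:
  assumes "recursive n F" shows "recursive n (\<lambda>xs. F xs - 1)"
proof -
  have "recursive n (\<lambda>xs. rec_nat 0 (\<lambda>y r. (\<lambda>ys. ys ! 0) (y # r # xs)) (F xs))"
    by (intro recursive_rec_nat assms rec_intros) simp
  moreover have "rec_nat 0 (\<lambda>y r. y) b = b - 1" for b :: nat by (cases b) auto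
  ultimately show ?thesis by simp
qed

lemma recursive_diff [rec_intros]:
  assumes "recursive n F" "recursive n G" shows "recursive n (\<lambda>xs. F xs - G xs)"
proof -
  have "recursive n (\<lambda>xs. rec_nat (F xs) (\<lambda>y r. (\<lambda>ys. ys ! 1 - 1) (y # r # xs)) (G xs))"
    by (intro recursive_rec_nat assms rec_intros) simp
  moreover have "rec_nat a (\<lambda>y r. r - 1) b = a - b" for a b :: nat by (induction b) auto
  ultimately show ?thesis by simp
qed

lemma recursive_mult [rec_intros]:
  assumes "recursive n F" "recursive n G" shows "recursive n (\<lambda>xs. F xs * G xs)"
proof -
  have "recursive 2 (\<lambda>xs. rec_nat 0 (\<lambda>y r. (\<lambda>ys. ys ! 1 + ys ! 2) (y # r # xs)) (xs ! 1))"
    by (intro recursive_rec_nat assms rec_intros) auto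
  moreover have "rec_nat 0 (\<lambda>y r. r + a) b = a * b" for a b :: nat by (induction b) auto
  ultimately have "recursive 2 (\<lambda>xs. xs ! 0 * xs ! 1)" by simp
  from recursive_comp2[OF this assms] show ?thesis .
qed

lemma recursive_if [rec_intros]:
  assumes "recursive n C" "recursive n F" "recursive n G"
  shows "recursive n (\<lambda>xs. if C xs = 0 then F xs else G xs)"
proof -
  have "recursive n (\<lambda>xs. (1 - C xs) * F xs + (1 - (1 - C xs)) * G xs)"
    by (intro rec_intros assms)
  then show ?thesis by (rule recursive_cong) auto
qed

lemma recursive_power2 [rec_intros]:
  assumes "recursive n F" shows "recursive n (\<lambda>xs. 2 ^ F xs :: nat)"
proof -
  have "recursive n (\<lambda>xs. rec_nat 1 (\<lambda>y r. (\<lambda>ys. ys ! 1 + ys ! 1) (y # r # xs)) (F xs))"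
    by (intro recursive_rec_nat assms rec_intros) auto
  moreover have "rec_nat 1 (\<lambda>y r. r + r) b = (2 ^ b :: nat)" for b :: nat by (induction b) auto
  ultimately show ?thesis by simp
qed

lemma recursive_mod2 [rec_intros]:
  assumes "recursive n F" shows "recursive n (\<lambda>xs. F xs mod 2)"
proof -
  have "recursive n (\<lambda>xs. rec_nat 0 (\<lambda>y r. (\<lambda>ys. 1 - ys ! 1) (y # r # xs)) (F xs))"
    by (intro recursive_rec_nat assms rec_intros) auto
  moreover have "rec_nat 0 (\<lambda>y r. 1 - r) b = b mod 2" for b :: nat
    by (induction b) (auto simp: mod_Suc)
  ultimately show ?thesis by simp
qed

lemma recursive_div2 [rec_intros]:
  assumes "recursive n F" shows "recursive n (\<lambda>xs. F xs div 2)"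
proof -
  have "recursive n (\<lambda>xs. rec_nat 0 (\<lambda>y r. (\<lambda>ys. ys ! 1 + ys ! 0 mod 2) (y # r # xs)) (F xs))"
    by (intro recursive_rec_nat assms rec_intros) auto
  moreover have "rec_nat 0 (\<lambda>y r. r + y mod 2) b = b div 2" for b :: nat
    by (induction b) (simp, simp, presburger)
  ultimately show ?thesis by simp
qed

lemma recursive_Least:
  assumes "recursive (Suc n) F" "\<And>xs. length xs = n \<Longrightarrow> \<exists>y. F (y # xs) = 0"
  shows "recursive n (\<lambda>xs. LEAST y. F (y # xs) = 0)"
  using assms by (intro recursive.mu) auto

lemma recursive_triangle [rec_intros]:
  "recursive n F \<Longrightarrow> recursive n (\<lambda>xs. triangle (F xs))"
  unfolding triangle_def by (intro rec_intros)

lemma recursive_prod_encode [rec_intros]: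
  "recursive n F \<Longrightarrow> recursive n G \<Longrightarrow> recursive n (\<lambda>xs. prod_encode (F xs, G xs))"
  unfolding prod_encode_def prod.case by (intro rec_intros)

lemma triangle_mono: "m \<le> n \<Longrightarrow> triangle m \<le> triangle n"
  unfolding triangle_def by (intro div_le_mono mult_le_mono) auto

text \<open>The diagonal on which \<open>m\<close> lies in the Cantor enumeration is found by unbounded search for the first
triangular number beyond \<open>m\<close>. The recursion
that defines the decoding function carries the diagonal along and is not of primitive recursive form.\<close>

lemma prod_decode_eq_triangle_search:
  fixes m :: nat
  defines "t \<equiv> LEAST t. Suc m - triangle (Suc t) = 0"
  shows "prod_decode m = (m - triangle t, t - (m - triangle t))"
proof -
  obtain a b where ab: "prod_decode m = (a, b)" by fastforce
  then have m: "m = triangle (a + b) + a"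
    using prod_decode_inverse[of m] by (simp add: prod_encode_def)
  have "t = a + b" unfolding t_def
  proof (rule Least_equality)
    show "Suc m - triangle (Suc (a + b)) = 0" using m by simp
    fix y assume y: "Suc m - triangle (Suc y) = 0"
    show "a + b \<le> y"
    proof (rule ccontr)
      assume "\<not> a + b \<le> y"
      then have "triangle (Suc y) \<le> triangle (a + b)" by (intro triangle_mono) simp
      then show False using y m by linarith
    qed
  qed
  then show ?thesis using ab m by simp
qed

lemma recursive_triangle_search:
  "recursive 1 (\<lambda>xs. LEAST t. Suc (xs ! 0) - triangle (Suc t) = 0)"
proof -
  have "recursive 1 (\<lambda>xs. LEAST t. (\<lambda>ys. Suc (ys ! 1) - triangle (Suc (ys ! 0))) (t # xs) = 0)"
  proof (rule recursive_Least)
    show "recursive (Suc 1) (\<lambda>ys. Suc (ys ! 1) - triangle (Suc (ys ! 0)))"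
      by (intro rec_intros) auto
    fix xs :: "nat list"
    show "\<exists>t. Suc ((t # xs) ! 1) - triangle (Suc ((t # xs) ! 0)) = 0"
      by (rule exI[of _ "xs ! 0"]) simp
  qed
  then show ?thesis by simp
qed

lemma recursive_fst_prod_decode [rec_intros]:
  assumes "recursive n F" shows "recursive n (\<lambda>xs. fst (prod_decode (F xs)))"
  unfolding prod_decode_eq_triangle_search fst_conv
  by (intro rec_intros recursive_comp1[OF recursive_triangle_search] assms)

lemma recursive_snd_prod_decode [rec_intros]:
  assumes "recursive n F" shows "recursive n (\<lambda>xs. snd (prod_decode (F xs)))"
  unfolding prod_decode_eq_triangle_search snd_conv
  by (intro rec_intros recursive_comp1[OF recursive_triangle_search] assms)

definition cons_code :: "nat \<Rightarrow> nat \<Rightarrow> nat" where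
  "cons_code x l = Suc (prod_encode (x, l))"

lemma list_decode_cons_code [simp]: "list_decode (cons_code x l) = x # list_decode l"
  by (simp add: cons_code_def)

lemma recursive_cons_code [rec_intros]:
  "recursive n F \<Longrightarrow> recursive n G \<Longrightarrow> recursive n (\<lambda>xs. cons_code (F xs) (G xs))"
  unfolding cons_code_def by (intro rec_intros)

text \<open>In the step of a primitive recursion the parameters follow the counter and the previous value.\<close>

lemma recursive_drop2:
  assumes "recursive n F" shows "recursive (n + 2) (\<lambda>ys. F (drop 2 ys))"
proof -
  let ?gs = "map (\<lambda>i xs. xs ! (i + 2)) [0..<n]"
  have "recursive (n + 2) (\<lambda>ys. F (map (\<lambda>h. h ys) ?gs))"
    by (rule recursive.comp) (use assms in \<open>auto intro: recursive.proj\<close>)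
  then show ?thesis
  proof (rule recursive_cong)
    fix ys :: "nat list" assume "length ys = n + 2"
    then have "drop 2 ys = map (\<lambda>i. ys ! (i + 2)) [0..<n]"
      by (intro nth_equalityI) (auto simp: add.commute)
    then show "F (drop 2 ys) = F (map (\<lambda>h. h ys) ?gs)" by (simp add: o_def)
  qed
qed

lemma recursive_proj_drop2 [rec_intros]: "i < n \<Longrightarrow> recursive (n + 2) (\<lambda>ys. drop 2 ys ! i)"
  by (rule recursive_drop2) (rule recursive_proj)

lemma recursive_comp_binary:
  assumes "recursive 2 f" "recursive n F" "recursive n G"
  shows "recursive n (\<lambda>xs. f [F xs, G xs])"
  using recursive.comp[of "[F, G]" f n] assms by (simp add: numeral_2_eq_2)

text \<open>One step of a loop that runs through a coded list; its state is the pair of the code of the remaining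
list and the accumulator.\<close>

definition fold_step :: "(nat \<Rightarrow> nat \<Rightarrow> nat) \<Rightarrow> nat \<Rightarrow> nat" where
  "fold_step g s = (if fst (prod_decode s) = 0 then s else
     prod_encode (snd (prod_decode (fst (prod_decode s) - 1)),
       g (fst (prod_decode (fst (prod_decode s) - 1))) (snd (prod_decode s))))"

text \<open>The code of a list is at least its length, so that it can serve as the number of iterations; on the
empty list the loop idles.\<close>

lemma fold_step_iterate:
  assumes "list_encode l \<le> k"
  shows "snd (prod_decode ((fold_step g ^^ k) (prod_encode (list_encode l, a)))) = fold g l a"
  using assms
proof (induction l arbitrary: a k)
  case Nil
  have "(fold_step g ^^ k) (prod_encode (0, a)) = prod_encode (0, a)"
    by (induction k) (simp_all add: fold_step_def)
  then show ?case by simp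
next
  case (Cons x l)
  from Cons.prems obtain k' where k: "k = Suc k'" by (cases k) auto
  have "list_encode l \<le> k'"
    using Cons.prems k le_prod_encode_2[of "list_encode l" x] by simp
  from Cons.IH[OF this, of "g x a"] show ?case
    by (simp add: k funpow_Suc_right fold_step_def del: funpow.simps)
qed

lemma recursive_fold:
  assumes g: "recursive (n + 2) (\<lambda>ys. g (ys ! 0) (ys ! 1) (drop 2 ys))"
    and A: "recursive n A" and L: "recursive n L"
  shows "recursive n (\<lambda>xs. fold (\<lambda>x r. g x r xs) (list_decode (L xs)) (A xs))"
proof -
  have G: "recursive (n + 2) (\<lambda>ys. g (F ys) (H ys) (drop 2 ys))"
    if F: "recursive (n + 2) F" and H: "recursive (n + 2) H" for F H
  proof -
    let ?gs = "F # H # map (\<lambda>i xs. xs ! (i + 2)) [0..<n]"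
    let ?f = "\<lambda>ys. g (ys ! 0) (ys ! 1) (drop 2 ys)"
    have "recursive (n + 2) (\<lambda>xs. ?f (map (\<lambda>h. h xs) ?gs))"
      by (rule recursive.comp) (use g F H in \<open>auto intro: recursive.proj\<close>)
    then show ?thesis
    proof (rule recursive_cong)
      fix xs :: "nat list" assume l: "length xs = n + 2"
      then have "drop 2 xs = map (\<lambda>i. xs ! (i + 2)) [0..<n]"
        by (intro nth_equalityI) (auto simp: add.commute)
      then show "g (F xs) (H xs) (drop 2 xs) = ?f (map (\<lambda>h. h xs) ?gs)"
        by (simp add: o_def)
    qed
  qed
  have "recursive n (\<lambda>xs. rec_nat (prod_encode (L xs, A xs))
      (\<lambda>y r. (\<lambda>ys. fold_step (\<lambda>x r. g x r (drop 2 ys)) (ys ! 1)) (y # r # xs)) (L xs))"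
    unfolding fold_step_def
    by (rule recursive_rec_nat) (intro rec_intros G A L; simp)+
  then have "recursive n (\<lambda>xs. snd (prod_decode (rec_nat (prod_encode (L xs, A xs))
      (\<lambda>y r. (\<lambda>ys. fold_step (\<lambda>x r. g x r (drop 2 ys)) (ys ! 1)) (y # r # xs)) (L xs))))"
    by (rule recursive_snd_prod_decode)
  then show ?thesis
  proof (rule recursive_cong)
    fix xs :: "nat list"
    have "rec_nat s (\<lambda>y. h) k = (h ^^ k) s" for s k and h :: "nat \<Rightarrow> nat"
      by (induction k) auto
    then show "fold (\<lambda>x r. g x r xs) (list_decode (L xs)) (A xs) =
        snd (prod_decode (rec_nat (prod_encode (L xs, A xs))
          (\<lambda>y r. (\<lambda>ys. fold_step (\<lambda>x r. g x r (drop 2 ys)) (ys ! 1)) (y # r # xs)) (L xs)))"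
      using fold_step_iterate[of "list_decode (L xs)" "L xs" "\<lambda>x r. g x r xs" "A xs"] by simp
  qed
qed

lemma recursive_sum:
  assumes g: "recursive (n + 2) (\<lambda>ys. g (ys ! 0) (drop 2 ys))" and L: "recursive n L"
  shows "recursive n (\<lambda>xs. \<Sum>i<L xs. g i xs)"
proof -
  have "recursive n (\<lambda>xs. rec_nat 0 (\<lambda>y r. (\<lambda>ys. ys ! 1 + g (ys ! 0) (drop 2 ys)) (y # r # xs)) (L xs))"
    by (intro recursive_rec_nat rec_intros g L) auto
  moreover have "rec_nat 0 (\<lambda>y r. r + h y) k = (\<Sum>i<k. h i)" for k and h :: "nat \<Rightarrow> nat"
    by (induction k) auto
  ultimately show ?thesis by simp
qed


section \<open>Recursive operations on codes of *-polynomials\<close>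

text \<open>The integer with code \<open>a\<close> has absolute value \<open>Suc a div 2\<close> and is negative exactly for odd \<open>a\<close>. The
truncated subtraction gives code 0 to every product that vanishes.\<close>

definition int_mult_code :: "nat \<Rightarrow> nat \<Rightarrow> nat" where
  "int_mult_code a b = 2 * ((Suc a div 2) * (Suc b div 2)) - (a + b) mod 2"

definition rat_mult_code :: "nat \<Rightarrow> nat \<Rightarrow> nat" where
  "rat_mult_code p q = prod_encode
     (int_mult_code (fst (prod_decode p)) (fst (prod_decode q)),
      int_mult_code (snd (prod_decode p)) (snd (prod_decode q)))"

text \<open>The codes 1 and 2 stand for the integers \<open>-1\<close> and 1.\<close>

definition rat_neg_code :: "nat \<Rightarrow> nat" where
  "rat_neg_code p = rat_mult_code (prod_encode (1, 2)) p"

text \<open>Consing one list onto another reverses it, hence the double reversal.\<close>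

definition append_code :: "nat \<Rightarrow> nat \<Rightarrow> nat" where
  "append_code l l' = fold cons_code (list_decode (fold cons_code (list_decode l) 0)) l'"

definition coeff_re :: "nat \<Rightarrow> nat" where
  "coeff_re m = fst (prod_decode (fst (prod_decode m)))"

definition coeff_im :: "nat \<Rightarrow> nat" where
  "coeff_im m = snd (prod_decode (fst (prod_decode m)))"

definition word_code :: "nat \<Rightarrow> nat" where
  "word_code m = snd (prod_decode m)"

definition monomial_code :: "nat \<Rightarrow> nat \<Rightarrow> nat \<Rightarrow> nat" where
  "monomial_code r s w = prod_encode (prod_encode (r, s), w)"

text \<open>The product of the coefficients \<open>r + s \<i>\<close> and \<open>r' + s' \<i>\<close> is kept as the sum of the two monomials with
coefficients \<open>r r' + r s' \<i>\<close> and \<open>- s s' + s r' \<i>\<close>, so that rational numbers need only be multiplied,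
never added: multiplying the components of fractions is correct even for zero denominators.\<close>

definition cons_monomial_product :: "nat \<Rightarrow> nat \<Rightarrow> nat \<Rightarrow> nat" where
  "cons_monomial_product m m' acc =
    cons_code (monomial_code (rat_mult_code (coeff_re m) (coeff_re m'))
        (rat_mult_code (coeff_re m) (coeff_im m')) (append_code (word_code m) (word_code m')))
     (cons_code (monomial_code (rat_neg_code (rat_mult_code (coeff_im m) (coeff_im m')))
        (rat_mult_code (coeff_im m) (coeff_re m')) (append_code (word_code m) (word_code m'))) acc)"

definition mult_code :: "nat \<Rightarrow> nat \<Rightarrow> nat" where
  "mult_code p q =
     fold (\<lambda>m acc. fold (cons_monomial_product m) (list_decode q) acc) (list_decode p) 0"

definition neg_code :: "nat \<Rightarrow> nat" where
  "neg_code p = fold (\<lambda>m acc. cons_code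
     (monomial_code (rat_neg_code (coeff_re m)) (rat_neg_code (coeff_im m)) (word_code m)) acc)
     (list_decode p) 0"

definition star_word_code :: "nat \<Rightarrow> nat" where
  "star_word_code w =
     fold (\<lambda>l acc. cons_code (if l mod 2 = 0 then Suc l else l - 1) acc) (list_decode w) 0"

definition star_code :: "nat \<Rightarrow> nat" where
  "star_code p = fold (\<lambda>m acc. cons_code
     (monomial_code (coeff_re m) (rat_neg_code (coeff_im m)) (star_word_code (word_code m))) acc)
     (list_decode p) 0"

text \<open>This and the next function return 0 when nothing is wrong. Letter \<open>l\<close> has index \<open>l div 2\<close>.\<close>

definition bad_letter :: "enat \<Rightarrow> nat \<Rightarrow> nat" where
  "bad_letter N l = (case N of enat k \<Rightarrow> 1 - (k - l div 2) | \<infinity> \<Rightarrow> 0)"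

definition bad_word :: "enat \<Rightarrow> nat \<Rightarrow> nat" where
  "bad_word N w = fold (\<lambda>l acc. acc + bad_letter N l) (list_decode w) (1 - w)"

text \<open>Whether a number is a code of a generated point depends on cancellation between its monomials. Deleting
all monomials with a forbidden word turns every number into a code and does not change the value
of a code, because the deleted monomials of a code cancel each other.\<close>

definition sanitize :: "enat \<Rightarrow> nat \<Rightarrow> nat" where
  "sanitize N e = fold (\<lambda>m acc. if bad_word N (word_code m) = 0 then cons_code m acc else acc)
     (list_decode e) 0"

text \<open>For positive \<open>x\<close> and \<open>y\<close> a test for \<open>\<bar>q\<bar> \<ge> y / x\<close>, with value 0 when it fails. The last
factor deals with a zero denominator, for which \<open>q\<close> is read as 0.\<close>

definition exceeds :: "nat \<Rightarrow> nat \<Rightarrow> nat \<Rightarrow> nat" where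
  "exceeds q x y = (Suc ((Suc (fst (prod_decode q)) div 2) * x) - (Suc (snd (prod_decode q)) div 2) * y)
     * (Suc (snd (prod_decode q)) div 2)"

lemma recursive_rat_mult_code [rec_intros]:
  "recursive n F \<Longrightarrow> recursive n G \<Longrightarrow> recursive n (\<lambda>xs. rat_mult_code (F xs) (G xs))"
  unfolding rat_mult_code_def int_mult_code_def by (intro rec_intros)

lemma recursive_rat_neg_code [rec_intros]:
  "recursive n F \<Longrightarrow> recursive n (\<lambda>xs. rat_neg_code (F xs))"
  unfolding rat_neg_code_def by (intro rec_intros)

lemma recursive_fold_cons [rec_intros]:
  "recursive n F \<Longrightarrow> recursive n G \<Longrightarrow>
    recursive n (\<lambda>xs. fold cons_code (list_decode (F xs)) (G xs))"
  by (rule recursive_fold) (intro rec_intros; simp)+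

lemma recursive_append_code [rec_intros]:
  "recursive n F \<Longrightarrow> recursive n G \<Longrightarrow> recursive n (\<lambda>xs. append_code (F xs) (G xs))"
  unfolding append_code_def by (intro rec_intros)

lemma recursive_monomial_parts [rec_intros]:
  "recursive n F \<Longrightarrow> recursive n (\<lambda>xs. coeff_re (F xs))"
  "recursive n F \<Longrightarrow> recursive n (\<lambda>xs. coeff_im (F xs))"
  "recursive n F \<Longrightarrow> recursive n (\<lambda>xs. word_code (F xs))"
  unfolding coeff_re_def coeff_im_def word_code_def by (intro rec_intros, assumption)+

lemma recursive_monomial_code [rec_intros]:
  "recursive n F \<Longrightarrow> recursive n G \<Longrightarrow> recursive n H \<Longrightarrow>
    recursive n (\<lambda>xs. monomial_code (F xs) (G xs) (H xs))"
  unfolding monomial_code_def by (intro rec_intros)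

lemma recursive_cons_monomial_product [rec_intros]:
  "recursive n F \<Longrightarrow> recursive n G \<Longrightarrow> recursive n H \<Longrightarrow>
    recursive n (\<lambda>xs. cons_monomial_product (F xs) (G xs) (H xs))"
  unfolding cons_monomial_product_def by (intro rec_intros)

lemma recursive_fold_monomial_product [rec_intros]:
  assumes "recursive n F" "recursive n G" "recursive n H"
  shows "recursive n (\<lambda>xs. fold (cons_monomial_product (F xs)) (list_decode (G xs)) (H xs))"
  by (rule recursive_fold) (intro rec_intros assms recursive_drop2; simp)+

lemma recursive_mult_code [rec_intros]:
  assumes "recursive n F" "recursive n G"
  shows "recursive n (\<lambda>xs. mult_code (F xs) (G xs))"
  unfolding mult_code_def
  by (rule recursive_fold) (intro rec_intros assms recursive_drop2[OF assms(2)]; simp)+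

lemma recursive_neg_code [rec_intros]:
  "recursive n F \<Longrightarrow> recursive n (\<lambda>xs. neg_code (F xs))"
  unfolding neg_code_def by (rule recursive_fold) (intro rec_intros; simp)+

lemma recursive_star_word_code [rec_intros]:
  "recursive n F \<Longrightarrow> recursive n (\<lambda>xs. star_word_code (F xs))"
  unfolding star_word_code_def by (rule recursive_fold) (intro rec_intros; simp)+

lemma recursive_star_code [rec_intros]:
  "recursive n F \<Longrightarrow> recursive n (\<lambda>xs. star_code (F xs))"
  unfolding star_code_def by (rule recursive_fold) (intro rec_intros; simp)+

lemma recursive_bad_letter [rec_intros]:
  "recursive n F \<Longrightarrow> recursive n (\<lambda>xs. bad_letter N (F xs))"
  unfolding bad_letter_def by (cases N) (auto intro!: rec_intros)

lemma recursive_bad_word [rec_intros]: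
  "recursive n F \<Longrightarrow> recursive n (\<lambda>xs. bad_word N (F xs))"
  unfolding bad_word_def by (rule recursive_fold) (intro rec_intros; simp)+

lemma recursive_sanitize [rec_intros]:
  "recursive n F \<Longrightarrow> recursive n (\<lambda>xs. sanitize N (F xs))"
  unfolding sanitize_def by (rule recursive_fold) (intro rec_intros; simp)+

lemma recursive_exceeds [rec_intros]:
  "recursive n F \<Longrightarrow> recursive n G \<Longrightarrow> recursive n H \<Longrightarrow>
    recursive n (\<lambda>xs. exceeds (F xs) (G xs) (H xs))"
  unfolding exceeds_def by (intro rec_intros)

section \<open>The values of codes\<close>

lemma int_decode_cases:
  obtains i where "n = 2 * i" "int_decode n = int i"
  | i where "n = Suc (2 * i)" "int_decode n = - int i - 1"
proof (cases "even n")
  case True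
  then obtain i where "n = 2 * i" by blast
  then show thesis using that(1) by (simp add: int_decode_def sum_decode_def)
next
  case False
  then obtain i where "n = Suc (2 * i)" using oddE by fastforce
  then show thesis using that(2) by (simp add: int_decode_def sum_decode_def)
qed

lemma int_decode_mult_code: "int_decode (int_mult_code a b) = int_decode a * int_decode b"
proof -
  have ev: "int_decode (2 * k) = int k" for k by (simp add: int_decode_def sum_decode_def)
  have od: "int_decode (2 * Suc k - 1) = - int (Suc k)" for k
    by (simp add: int_decode_def sum_decode_def)
  have od': "int_decode (2 * k - 1) = - int k" if "k > 0" for k
    using that od[of "k - 1"] by simp
  have od'': "int_decode (2 * k - Suc 0) = - int k" for k
    using od'[of k] ev[of 0] by (cases "k = 0") auto
  show ?thesis
  proof (cases a rule: int_decode_cases)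
    case (1 i)
    show ?thesis
    proof (cases b rule: int_decode_cases)
      case (1 j)
      with \<open>a = 2 * i\<close> \<open>int_decode a = int i\<close> show ?thesis by (simp add: int_mult_code_def ev)
    next
      case (2 j)
      then have "int_mult_code a b = 2 * (i * Suc j) - Suc 0"
        using \<open>a = 2 * i\<close> by (simp add: int_mult_code_def mod_Suc mod_mult_self1)
      then show ?thesis using 2 \<open>int_decode a = int i\<close> by (simp only: od'') (simp add: algebra_simps)
    qed
  next
    case (2 i)
    show ?thesis
    proof (cases b rule: int_decode_cases)
      case (1 j)
      then have "int_mult_code a b = 2 * (Suc i * j) - Suc 0"
        using \<open>a = Suc (2 * i)\<close> by (simp add: int_mult_code_def mod_Suc)
      then show ?thesis using 1 \<open>int_decode a = - int i - 1\<close> by (simp only: od'') (simp add: algebra_simps)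
    next
      case (2 j)
      then have "int_mult_code a b = 2 * (Suc i * Suc j)"
        using \<open>a = Suc (2 * i)\<close> by (simp add: int_mult_code_def mod_Suc)
      then show ?thesis using 2 \<open>int_decode a = - int i - 1\<close> by (simp only: ev) (simp add: algebra_simps)
    qed
  qed
qed

definition rat_value :: "nat \<Rightarrow> real" where
  "rat_value q = real_of_rat (nat_to_rat_surj q)"

lemma rat_value_eq:
  "rat_value q = of_int (int_decode (fst (prod_decode q))) / of_int (int_decode (snd (prod_decode q)))"
  by (simp add: rat_value_def nat_to_rat_surj_def case_prod_beta Let_def Fract_of_int_quotient of_rat_divide)

lemma rat_value_mult: "rat_value (rat_mult_code p q) = rat_value p * rat_value q"
  by (simp add: rat_value_eq rat_mult_code_def int_decode_mult_code)

lemma rat_value_neg: "rat_value (rat_neg_code p) = - rat_value p"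
proof -
  have "rat_value (prod_encode (1, 2)) = - 1"
    by (simp add: rat_value_eq int_decode_def sum_decode_def)
  then show ?thesis by (simp add: rat_neg_code_def rat_value_mult)
qed

lemma abs_int_decode: "\<bar>int_decode n\<bar> = int (Suc n div 2)"
  by (cases n rule: int_decode_cases) auto

lemma exceeds_eq_0_iff:
  assumes "x > 0" "y > 0"
  shows "exceeds q x y = 0 \<longleftrightarrow> \<bar>rat_value q\<bar> < real y / real x"
proof -
  obtain a b where ab: "prod_decode q = (a, b)" by fastforce
  have "\<bar>rat_value q\<bar> = real (Suc a div 2) / real (Suc b div 2)"
    by (simp add: rat_value_eq ab abs_divide abs_int_decode flip: of_int_abs)
  moreover have "exceeds q x y = 0 \<longleftrightarrow> Suc a div 2 * x < Suc b div 2 * y \<or> Suc b div 2 = 0"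
    unfolding exceeds_def ab fst_conv snd_conv mult_is_0 by linarith
  moreover have "i * x < j * y \<or> j = 0 \<longleftrightarrow> real i / real j < real y / real x" for i j
    using assms by (cases "j = 0") (auto simp: field_simps simp flip: of_nat_mult)
  ultimately show ?thesis by simp
qed

subsection \<open>x\<close>

definition monomial_coeff :: "nat \<Rightarrow> complex" where
  "monomial_coeff m = Complex (rat_value (coeff_re m)) (rat_value (coeff_im m))"

definition word :: "nat \<Rightarrow> letter list" where
  "word w = map letter_decode (list_decode w)"

definition monomial_value :: "(nat \<Rightarrow> 'a::cstar_algebra) \<Rightarrow> nat \<Rightarrow> 'a" where
  "monomial_value a m = monomial_coeff m *\<^sub>C eval_word a (word (word_code m))"

definition code_value :: "(nat \<Rightarrow> 'a::cstar_algebra) \<Rightarrow> nat \<Rightarrow> 'a" where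
  "code_value a e = sum_list (map (monomial_value a) (list_decode e))"

lemma monomial_decode_eq:
  "monomial_decode m = Poly_Mapping.single (word (word_code m)) (monomial_coeff m)"
  by (simp add: monomial_decode_def word_def word_code_def monomial_coeff_def coeff_decode_def
      coeff_re_def coeff_im_def rat_value_def case_prod_beta)

lemma eval_poly_add: "eval_poly a (p + q) = eval_poly a p + eval_poly a q"
proof -
  let ?K = "Poly_Mapping.keys p \<union> Poly_Mapping.keys q"
  have ext: "eval_poly a r = (\<Sum>w\<in>?K. Poly_Mapping.lookup r w *\<^sub>C eval_word a w)"
    if "Poly_Mapping.keys r \<subseteq> ?K" for r
    unfolding eval_poly_def by (rule sum.mono_neutral_left) (use that in \<open>auto simp: in_keys_iff\<close>)
  show ?thesis
    using ext[of p] ext[of q] ext[of "p + q"] keys_add[of p q]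
    by (simp add: lookup_add scaleC_add_left sum.distrib)
qed

lemma eval_poly_decode: "eval_poly a (poly_decode e) = code_value a e"
proof -
  have s: "eval_poly a (Poly_Mapping.single w c) = c *\<^sub>C eval_word a w" for w c
    by (simp add: eval_poly_def)
  have "eval_poly a (sum_list (map monomial_decode ms)) = sum_list (map (monomial_value a) ms)" for ms
    by (induction ms) (simp_all add: eval_poly_add monomial_decode_eq s monomial_value_def,
        simp add: eval_poly_def)
  then show ?thesis by (simp add: poly_decode_def code_value_def)
qed

lemma generated_point_eq: "generated_point P e = code_value (special P) e"
  by (simp add: generated_point_def eval_poly_decode)

lemma code_value_0 [simp]: "code_value a 0 = 0" by (simp add: code_value_def)

lemma code_value_cons_code [simp]: "code_value a (cons_code m l) = monomial_value a m + code_value a l"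
  by (simp add: code_value_def)

lemma monomial_code_parts [simp]:
  "monomial_coeff (monomial_code r s w) = Complex (rat_value r) (rat_value s)"
  "word_code (monomial_code r s w) = w"
  by (simp_all add: monomial_code_def monomial_coeff_def word_code_def coeff_re_def coeff_im_def)

lemma list_decode_fold_cons_code:
  "list_decode (fold (\<lambda>m acc. cons_code (f m) acc) ms acc) = rev (map f ms) @ list_decode acc"
  by (induction ms arbitrary: acc) auto

lemma list_decode_append_code [simp]:
  "list_decode (append_code l l') = list_decode l @ list_decode l'"
  using list_decode_fold_cons_code[of id] by (simp add: append_code_def)

lemma word_append_code [simp]: "word (append_code v w) = word v @ word w"
  by (simp add: word_def)

lemma code_value_append_code: "code_value a (append_code p q) = code_value a p + code_value a q"
  by (simp add: code_value_def)

lemma eval_word_append: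
  "v \<noteq> [] \<Longrightarrow> w \<noteq> [] \<Longrightarrow> eval_word a (v @ w) = eval_word a v * eval_word a w"
proof (induction a v rule: eval_word.induct)
  case (2 a l)
  then show ?case by (cases w) auto
qed (auto simp: mult.assoc)

fun letter_star :: "letter \<Rightarrow> letter" where
  "letter_star (Var i) = VarStar i"
| "letter_star (VarStar i) = Var i"

lemma letter_index_star [simp]: "letter_index (letter_star l) = letter_index l"
  by (cases l) auto

lemma eval_word_star: "eval_word a (rev (map letter_star w)) = star (eval_word a w)"
proof (induction a w rule: eval_word.induct)
  case (2 a l)
  then show ?case by (cases l) (auto simp: star_star)
next
  case (3 a l l' w)
  have "eval_letter a (letter_star l) = star (eval_letter a l)"
    by (cases l) (auto simp: star_star)
  moreover have "eval_word a (rev (map letter_star (l' # w)) @ [letter_star l]) =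
      eval_word a (rev (map letter_star (l' # w))) * eval_letter a (letter_star l)"
    by (subst eval_word_append) auto
  ultimately show ?case using 3 by (simp add: star_mult)
qed simp

lemma letter_decode_swap:
  "letter_decode (if l mod 2 = 0 then Suc l else l - 1) = letter_star (letter_decode l)"
  by (auto simp: letter_decode_def sum_decode_def elim!: evenE oddE)

lemma word_star_word_code [simp]: "word (star_word_code w) = rev (map letter_star (word w))"
  unfolding star_word_code_def word_def list_decode_fold_cons_code
  by (simp add: rev_map letter_decode_swap)

lemma code_value_star_code: "code_value a (star_code p) = star (code_value a p)"
proof -
  have m: "monomial_value a (monomial_code (coeff_re m) (rat_neg_code (coeff_im m))
      (star_word_code (word_code m))) = star (monomial_value a m)" for m
    by (simp add: monomial_value_def eval_word_star star_scaleC rat_value_neg)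
      (simp add: monomial_coeff_def complex_cnj)
  have "sum_list (map (\<lambda>m. star (monomial_value a m)) ms) = star (sum_list (map (monomial_value a) ms))" for ms
    by (induction ms) (auto simp: star_add)
  then show ?thesis
    by (simp add: code_value_def star_code_def list_decode_fold_cons_code m o_def flip: rev_map)
qed

lemma code_value_neg_code: "code_value a (neg_code p) = - code_value a p"
proof -
  have m: "monomial_value a (monomial_code (rat_neg_code (coeff_re m)) (rat_neg_code (coeff_im m))
      (word_code m)) = - monomial_value a m" for m
  proof -
    have "Complex (- x) (- y) = - Complex x y" for x y by (simp add: complex_eq_iff)
    then show ?thesis
      by (simp add: monomial_value_def rat_value_neg flip: scaleC_minus_left)
        (simp add: monomial_coeff_def)
  qed
  have "sum_list (map (\<lambda>m. - monomial_value a m) ms) = - sum_list (map (monomial_value a) ms)" for ms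
    by (induction ms) auto
  then show ?thesis
    by (simp add: code_value_def neg_code_def list_decode_fold_cons_code m o_def flip: rev_map)
qed

text \<open>A good code is one in which every single monomial is admissible. Concatenating words
multiplies their values only if both are nonempty, since the empty word has the dummy value 0; products
are therefore computed on good codes.\<close>

definition good_word :: "enat \<Rightarrow> letter list \<Rightarrow> bool" where
  "good_word N w \<longleftrightarrow> w \<noteq> [] \<and> (\<forall>l\<in>set w. enat (letter_index l) < N)"

definition good_code :: "enat \<Rightarrow> nat \<Rightarrow> bool" where
  "good_code N e \<longleftrightarrow> (\<forall>m\<in>set (list_decode e). good_word N (word (word_code m)))"

lemma code_value_cons_monomial_product:
  assumes "word (word_code m) \<noteq> []" "word (word_code m') \<noteq> []"
  shows "code_value a (cons_monomial_product m m' acc) = monomial_value a m * monomial_value a m' + code_value a acc"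
proof -
  have "monomial_coeff m * monomial_coeff m' =
      Complex (rat_value (coeff_re m) * rat_value (coeff_re m')) (rat_value (coeff_re m) * rat_value (coeff_im m'))
    + Complex (- (rat_value (coeff_im m) * rat_value (coeff_im m'))) (rat_value (coeff_im m) * rat_value (coeff_re m'))"
    by (simp add: monomial_coeff_def complex_eq_iff)
  then show ?thesis
    using assms
    by (simp add: cons_monomial_product_def monomial_value_def rat_value_mult rat_value_neg
        eval_word_append mult_scaleC_left mult_scaleC_right scaleC_scaleC scaleC_add_left
        add.assoc mult.commute[of "monomial_coeff m'"])
qed

lemma code_value_mult_code:
  assumes "good_code N p" "good_code N q"
  shows "code_value a (mult_code p q) = code_value a p * code_value a q"
proof -
  have inner: "code_value a (fold (cons_monomial_product m) ns acc) =
      monomial_value a m * sum_list (map (monomial_value a) ns) + code_value a acc"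
    if "\<forall>m'\<in>insert m (set ns). word (word_code m') \<noteq> []" for m ns acc
    using that
    by (induction ns arbitrary: acc) (auto simp: code_value_cons_monomial_product algebra_simps)
  have "code_value a (fold (\<lambda>m acc. fold (cons_monomial_product m) ns acc) ms acc) =
      sum_list (map (monomial_value a) ms) * sum_list (map (monomial_value a) ns) + code_value a acc"
    if "\<forall>m'\<in>set ms \<union> set ns. word (word_code m') \<noteq> []" for ms ns acc
    using that by (induction ms arbitrary: acc) (auto simp: inner algebra_simps)
  from this[of "list_decode p" "list_decode q" 0] show ?thesis
    using assms unfolding mult_code_def good_code_def good_word_def by (auto simp: code_value_def)
qed

lemma good_cons_code [simp]:
  "good_code N (cons_code m l) \<longleftrightarrow> good_word N (word (word_code m)) \<and> good_code N l"
  by (simp add: good_code_def)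

lemma good_0 [simp]: "good_code N 0" by (simp add: good_code_def)

lemma good_append_code: "good_code N p \<Longrightarrow> good_code N q \<Longrightarrow> good_code N (append_code p q)"
  by (auto simp: good_code_def)

lemma good_neg_code: "good_code N p \<Longrightarrow> good_code N (neg_code p)"
  by (auto simp: good_code_def neg_code_def list_decode_fold_cons_code)

lemma good_star_code: "good_code N p \<Longrightarrow> good_code N (star_code p)"
  by (auto simp: good_code_def star_code_def list_decode_fold_cons_code good_word_def)

lemma good_mult_code:
  assumes "good_code N p" "good_code N q"
  shows "good_code N (mult_code p q)"
proof -
  have cons: "good_code N (cons_monomial_product m m' acc)"
    if "good_word N (word (word_code m))" "good_word N (word (word_code m'))" "good_code N acc" for m m' acc
    using that by (auto simp: cons_monomial_product_def good_word_def)
  have inner: "good_code N (fold (cons_monomial_product m) ns acc)"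
    if "\<forall>m'\<in>insert m (set ns). good_word N (word (word_code m'))" "good_code N acc" for m ns acc
    using that by (induction ns arbitrary: acc) (auto simp: cons)
  have "good_code N (fold (\<lambda>m acc. fold (cons_monomial_product m) ns acc) ms acc)"
    if "\<forall>m'\<in>set ms \<union> set ns. good_word N (word (word_code m'))" "good_code N acc" for ms ns acc
    using that by (induction ms arbitrary: acc) (auto simp: inner)
  from this[of "list_decode p" "list_decode q" 0] show ?thesis
    using assms unfolding mult_code_def good_code_def[of _ p] good_code_def[of _ q] by auto
qed

lemma bad_word_eq_0_iff: "bad_word N w = 0 \<longleftrightarrow> good_word N (word w)"
proof -
  have l: "bad_letter N l = 0 \<longleftrightarrow> enat (letter_index (letter_decode l)) < N" for l
    by (cases N) (auto simp: bad_letter_def letter_decode_def sum_decode_def)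
  have f: "fold (\<lambda>l acc. acc + bad_letter N l) ls k = 0 \<longleftrightarrow>
      k = 0 \<and> (\<forall>l\<in>set ls. enat (letter_index (letter_decode l)) < N)" for ls k
    by (induction ls arbitrary: k) (auto simp: l)
  have "1 - w = 0 \<longleftrightarrow> word w \<noteq> []"
    by (cases w) (auto simp: word_def case_prod_beta)
  then show ?thesis by (simp add: bad_word_def f good_word_def) (simp add: word_def)
qed

lemma list_decode_sanitize:
  "list_decode (sanitize N e) = rev (filter (\<lambda>m. good_word N (word (word_code m))) (list_decode e))"
proof -
  have "list_decode (fold (\<lambda>m acc. if bad_word N (word_code m) = 0 then cons_code m acc else acc) ms acc)
      = rev (filter (\<lambda>m. good_word N (word (word_code m))) ms) @ list_decode acc" for ms acc
    by (induction ms arbitrary: acc) (auto simp: bad_word_eq_0_iff)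
  then show ?thesis by (simp add: sanitize_def)
qed

lemma good_sanitize: "good_code N (sanitize N e)"
  by (auto simp: good_code_def list_decode_sanitize)

lemma lookup_poly_decode:
  "Poly_Mapping.lookup (poly_decode e) w =
    sum_list (map monomial_coeff (filter (\<lambda>m. word (word_code m) = w) (list_decode e)))"
proof -
  have "Poly_Mapping.lookup (sum_list (map monomial_decode ms)) w =
    sum_list (map monomial_coeff (filter (\<lambda>m. word (word_code m) = w) ms))" for ms
    by (induction ms) (auto simp: lookup_add monomial_decode_eq lookup_single)
  then show ?thesis by (simp add: poly_decode_def)
qed

lemma is_code_if_good:
  assumes g: "good_code (num_special P) e"
  shows "is_code P e"
proof -
  have z: "Poly_Mapping.lookup (poly_decode e) w = 0" if "\<not> good_word (num_special P) w" for w
  proof -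
    have "filter (\<lambda>m. word (word_code m) = w) (list_decode e) = []"
      using g that by (auto simp: filter_empty_conv good_code_def)
    then show ?thesis by (simp only: lookup_poly_decode) simp
  qed
  have "Re (sum_list (map monomial_coeff ms)) \<in> \<rat> \<and> Im (sum_list (map monomial_coeff ms)) \<in> \<rat>" for ms
    by (induction ms) (auto simp: monomial_coeff_def rat_value_def)
  then have "Re (Poly_Mapping.lookup (poly_decode e) w) \<in> \<rat> \<and> Im (Poly_Mapping.lookup (poly_decode e) w) \<in> \<rat>" for w
    by (simp only: lookup_poly_decode)
  moreover have "Poly_Mapping.lookup (poly_decode e) [] = 0" by (rule z) (simp add: good_word_def)
  moreover have "good_word (num_special P) w" if "w \<in> Poly_Mapping.keys (poly_decode e)" for w
    using z[of w] that by (auto simp: in_keys_iff)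
  ultimately show ?thesis
    by (auto simp: is_code_def rational_star_poly_def poly_vars_def good_word_def)
qed

text \<open>The total coefficient of each forbidden word in the polynomial of a code is 0.\<close>

lemma poly_decode_sanitize:
  assumes c: "is_code P e"
  shows "poly_decode (sanitize (num_special P) e) = poly_decode e"
proof (rule poly_mapping_eqI)
  fix w
  let ?N = "num_special P"
  show "Poly_Mapping.lookup (poly_decode (sanitize ?N e)) w = Poly_Mapping.lookup (poly_decode e) w"
  proof (cases "good_word ?N w")
    case True
    have "filter (\<lambda>m. word (word_code m) = w) (list_decode (sanitize ?N e)) =
        rev (filter (\<lambda>m. word (word_code m) = w) (list_decode e))"
      using True by (auto simp: list_decode_sanitize rev_filter intro!: arg_cong[where f = rev] filter_cong)
    then show ?thesis by (simp add: lookup_poly_decode flip: rev_map)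
  next
    case False
    have "is_code P (sanitize ?N e)" by (rule is_code_if_good) (rule good_sanitize)
    with c have "Poly_Mapping.lookup (poly_decode d) w = 0" if "is_code P d" for d
      using that False
      by (auto simp: is_code_def rational_star_poly_def poly_vars_def in_keys_iff good_word_def)
    then show ?thesis using c \<open>is_code P (sanitize ?N e)\<close> by simp
  qed
qed

lemma generated_point_sanitize:
  "is_code P e \<Longrightarrow> generated_point P (sanitize (num_special P) e) = generated_point P e"
  by (simp add: generated_point_def poly_decode_sanitize)

section \<open>Density of the values of good codes\<close>

lemma tendsto_scaleC:
  fixes x :: "'a::cstar_algebra"
  assumes "f \<longlonglongrightarrow> x"
  shows "(\<lambda>n. c *\<^sub>C f n) \<longlonglongrightarrow> c *\<^sub>C x"
proof -
  have "(\<lambda>n. norm (f n - x)) \<longlonglongrightarrow> 0"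
    using assms by (simp add: tendsto_norm_zero_iff LIM_zero_iff)
  then have "(\<lambda>n. norm (c *\<^sub>C f n - c *\<^sub>C x)) \<longlonglongrightarrow> 0"
    using tendsto_mult_left[of _ 0 _ "cmod c"] by (simp add: norm_scaleC flip: scaleC_diff_right)
  then show ?thesis by (simp add: tendsto_norm_zero_iff LIM_zero_iff)
qed

lemma tendsto_star:
  fixes x :: "'a::cstar_algebra"
  assumes "f \<longlonglongrightarrow> x"
  shows "(\<lambda>n. star (f n)) \<longlonglongrightarrow> star x"
proof -
  have "(\<lambda>n. norm (star (f n) - star x)) \<longlonglongrightarrow> 0"
    using assms by (simp add: tendsto_norm_zero_iff LIM_zero_iff flip: star_diff)
  then show ?thesis by (simp add: tendsto_norm_zero_iff LIM_zero_iff)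
qed

lemma coeff_code_exists:
  assumes "Re c \<in> \<rat>" "Im c \<in> \<rat>"
  shows "\<exists>r s. Complex (rat_value r) (rat_value s) = c"
  using surj_of_rat_nat_to_rat_surj[OF assms(1)] surj_of_rat_nat_to_rat_surj[OF assms(2)]
  by (auto simp: rat_value_def complex_eq_iff)

lemma scaled_code_exists:
  assumes e: "good_code N e" and c: "Re c \<in> \<rat>" "Im c \<in> \<rat>"
  shows "\<exists>e'. good_code N e' \<and> code_value a e' = c *\<^sub>C code_value a e"
proof -
  have "\<exists>r s. Complex (rat_value r) (rat_value s) = c * monomial_coeff m" for m
    using c by (intro coeff_code_exists) (auto simp: monomial_coeff_def rat_value_def)
  then obtain r s where rs: "\<And>m. Complex (rat_value (r m)) (rat_value (s m)) = c * monomial_coeff m"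
    by metis
  let ?e = "list_encode (map (\<lambda>m. monomial_code (r m) (s m) (word_code m)) (list_decode e))"
  have "sum_list (map (\<lambda>m. c *\<^sub>C monomial_value a m) ms) = c *\<^sub>C sum_list (map (monomial_value a) ms)" for ms
    by (induction ms) (auto simp: scaleC_add_right)
  then have "code_value a ?e = c *\<^sub>C code_value a e"
    by (simp add: code_value_def o_def monomial_value_def rs flip: scaleC_scaleC)
  moreover have "good_code N ?e" using e by (simp add: good_code_def)
  ultimately show ?thesis by blast
qed

lemma rational_complex_dense:
  assumes "\<epsilon> > 0"
  shows "\<exists>d. Re d \<in> \<rat> \<and> Im d \<in> \<rat> \<and> cmod (d - c) < \<epsilon>"
proof -
  have ap: "\<exists>q\<in>\<rat>. \<bar>q - x\<bar> < \<epsilon> / 2" for x :: real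
  proof -
    obtain q where "q \<in> \<rat>" "x - \<epsilon> / 2 < q" "q < x + \<epsilon> / 2"
      using Rats_dense_in_real[of "x - \<epsilon> / 2" "x + \<epsilon> / 2"] assms by auto
    then show ?thesis by (intro bexI[of _ q]) linarith+
  qed
  obtain q r where "q \<in> \<rat>" "r \<in> \<rat>" "\<bar>q - Re c\<bar> < \<epsilon> / 2" "\<bar>r - Im c\<bar> < \<epsilon> / 2"
    using ap by meson
  then show ?thesis
    using cmod_le[of "Complex q r - c"] by (intro exI[of _ "Complex q r"]) auto
qed

text \<open>Values of good codes are closed under the operations of a *-subalgebra except for scaling by irrational
complex numbers, which is recovered in the closure.\<close>

lemma good_codes_dense:
  fixes P :: "'a::cstar_algebra presentation"
  assumes P: "is_presentation P"
  shows "closure {generated_point P e |e. good_code (num_special P) e} = UNIV"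
proof -
  let ?N = "num_special P"
  let ?G = "{generated_point P e |e. good_code (num_special P) e}"
  have scale0: "c *\<^sub>C x \<in> closure ?G" if "x \<in> ?G" for c x
    unfolding closure_approachable
  proof (intro allI impI)
    fix \<epsilon> :: real assume \<epsilon>: "\<epsilon> > 0"
    have p: "norm x + 1 > 0" using norm_ge_zero[of x] by linarith
    with \<epsilon> have "\<epsilon> / (norm x + 1) > 0" by simp
    then obtain d where d: "Re d \<in> \<rat>" "Im d \<in> \<rat>" "cmod (d - c) < \<epsilon> / (norm x + 1)"
      using rational_complex_dense by blast
    from that obtain e where e: "good_code ?N e" "x = generated_point P e" by blast
    obtain e' where e': "good_code ?N e'" "generated_point P e' = d *\<^sub>C x"
      using scaled_code_exists[OF e(1) d(1,2), of "special P"] e(2) by (auto simp: generated_point_eq)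
    have "dist (d *\<^sub>C x) (c *\<^sub>C x) = cmod (d - c) * norm x"
      by (simp add: dist_norm norm_scaleC flip: scaleC_diff_left)
    also have "\<dots> \<le> cmod (d - c) * (norm x + 1)" by (intro mult_left_mono) auto
    also have "\<dots> < \<epsilon>" using d(3) p by (simp add: field_simps)
    finally have "dist (d *\<^sub>C x) (c *\<^sub>C x) < \<epsilon>" .
    moreover have "d *\<^sub>C x \<in> ?G" unfolding e'(2)[symmetric] using e'(1) by blast
    ultimately show "\<exists>y\<in>?G. dist y (c *\<^sub>C x) < \<epsilon>" by (rule bexI)
  qed
  have binary: "b x y \<in> closure ?G"
    if x: "x \<in> closure ?G" and y: "y \<in> closure ?G"
      and G: "\<And>x y. x \<in> ?G \<Longrightarrow> y \<in> ?G \<Longrightarrow> b x y \<in> ?G"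
      and lim: "\<And>f g. f \<longlonglongrightarrow> x \<Longrightarrow> g \<longlonglongrightarrow> y \<Longrightarrow> (\<lambda>n. b (f n) (g n)) \<longlonglongrightarrow> b x y"
    for b x y
  proof -
    obtain f where f: "\<forall>n. f n \<in> ?G" "f \<longlonglongrightarrow> x" using x unfolding closure_sequential by blast
    obtain g where g: "\<forall>n. g n \<in> ?G" "g \<longlonglongrightarrow> y" using y unfolding closure_sequential by blast
    have "\<forall>n. b (f n) (g n) \<in> ?G" using f(1) g(1) G by blast
    with lim[OF f(2) g(2)] show ?thesis
      unfolding closure_sequential by (intro exI[of _ "\<lambda>n. b (f n) (g n)"] conjI)
  qed
  have "star_subalgebra (closure ?G)"
    unfolding star_subalgebra_def
  proof (intro conjI ballI allI)
    show "0 \<in> closure ?G"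
      using closure_subset[of ?G] good_0[of ?N] generated_point_eq[of P 0] by force
    fix x y assume x: "x \<in> closure ?G" and y: "y \<in> closure ?G"
    show "x + y \<in> closure ?G"
    proof (rule binary[OF x y])
      fix x y assume "x \<in> ?G" "y \<in> ?G"
      then obtain p q where "x = generated_point P p" "y = generated_point P q"
        "good_code ?N p" "good_code ?N q" by blast
      then have "x + y = generated_point P (append_code p q) \<and> good_code ?N (append_code p q)"
        by (simp add: generated_point_eq code_value_append_code good_append_code)
      then show "x + y \<in> ?G" by blast
    qed (rule tendsto_add)
    show "x * y \<in> closure ?G"
    proof (rule binary[OF x y])
      fix x y assume "x \<in> ?G" "y \<in> ?G"
      then obtain p q where "x = generated_point P p" "y = generated_point P q"
        "good_code ?N p" "good_code ?N q" by blast
      then have "x * y = generated_point P (mult_code p q) \<and> good_code ?N (mult_code p q)"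
        by (simp add: generated_point_eq code_value_mult_code good_mult_code)
      then show "x * y \<in> ?G" by blast
    qed (rule tendsto_mult)
  next
    fix c x assume "x \<in> closure ?G"
    then obtain f where f: "\<And>n. f n \<in> ?G" "f \<longlonglongrightarrow> x" unfolding closure_sequential by blast
    show "c *\<^sub>C x \<in> closure ?G"
      by (rule closed_sequentially[OF closed_closure _ tendsto_scaleC[OF f(2)]]) (rule scale0[OF f(1)])
  next
    fix x assume x: "x \<in> closure ?G"
    show "star x \<in> closure ?G"
    proof (rule binary[OF x x])
      fix x y assume "x \<in> ?G"
      then obtain p where "x = generated_point P p" "good_code ?N p" by blast
      then have "star x = generated_point P (star_code p) \<and> good_code ?N (star_code p)"
        by (simp add: generated_point_eq code_value_star_code good_star_code)
      then show "star x \<in> ?G" by blast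
    qed (rule tendsto_star)
  qed
  moreover have "{special P n |n. enat n < ?N} \<subseteq> closure ?G"
  proof (clarify)
    fix n assume n: "enat n < ?N"
    \<comment> \<open>The fraction codes stand for \<open>1 / 1\<close> and for \<open>0 / 0 = 0\<close>.\<close>
    let ?m = "monomial_code (prod_encode (2, 2)) (prod_encode (0, 0)) (list_encode [sum_encode (Inl n)])"
    have w: "word (word_code ?m) = [Var n]" by (simp add: word_def letter_decode_def)
    have c: "monomial_coeff ?m = 1"
      by (simp add: rat_value_eq int_decode_def sum_decode_def complex_eq_iff)
    have "generated_point P (cons_code ?m 0) = special P n"
      unfolding generated_point_eq code_value_cons_code monomial_value_def w c by simp
    moreover have "good_code ?N (cons_code ?m 0)"
      unfolding good_cons_code w using n by (simp add: good_word_def)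
    ultimately have "special P n \<in> ?G" by (metis (mono_tags, lifting) mem_Collect_eq)
    then show "special P n \<in> closure ?G" by (rule subsetD[OF closure_subset])
  qed
  ultimately have "star_subalgebra hull {special P n |n. enat n < ?N} \<subseteq> closure ?G"
    by (intro hull_minimal)
  then have "closure (star_subalgebra hull {special P n |n. enat n < ?N}) \<subseteq> closure ?G"
    by (intro closure_minimal) auto
  then show ?thesis using P by (auto simp: is_presentation_def)
qed

lemma tendsto_identity_if_dense:
  fixes T :: "nat \<Rightarrow> 'a::real_normed_vector \<Rightarrow> 'a"
  assumes diff: "\<And>n x y. T n (x - y) = T n x - T n y"
    and bound: "\<And>n x. norm (T n x) \<le> C * norm x"
    and dense: "closure D = UNIV"
    and lim: "\<And>r. r \<in> D \<Longrightarrow> (\<lambda>n. T n r) \<longlonglongrightarrow> r"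
  shows "(\<lambda>n. T n a) \<longlonglongrightarrow> a"
proof (rule LIMSEQ_I)
  fix \<epsilon> :: real assume \<epsilon>: "\<epsilon> > 0"
  define K where "K = \<bar>C\<bar> + 1"
  have K: "K > 0" by (simp add: K_def)
  have "a \<in> closure D" using dense by simp
  then obtain r where r: "r \<in> D" "norm (a - r) < \<epsilon> / (2 * K)"
    unfolding closure_approachable using \<epsilon> K
    by (metis dist_commute dist_norm divide_pos_pos mult_pos_pos zero_less_numeral)
  obtain n0 where n0: "\<And>n. n \<ge> n0 \<Longrightarrow> norm (T n r - r) < \<epsilon> / 2"
    using LIMSEQ_D[OF lim[OF r(1)], of "\<epsilon> / 2"] \<epsilon> by auto
  have "norm (T n a - a) < \<epsilon>" if "n \<ge> n0" for n
  proof -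
    have "T n a - a = T n (a - r) + (T n r - r) - (a - r)" by (simp add: diff)
    then have "norm (T n a - a) \<le> norm (T n (a - r)) + norm (T n r - r) + norm (a - r)"
      by (metis norm_triangle_ineq4 norm_triangle_ineq add_right_mono order_trans)
    also have "norm (T n (a - r)) \<le> \<bar>C\<bar> * norm (a - r)"
      using bound[of n "a - r"] by (meson abs_ge_self mult_right_mono norm_ge_zero order_trans)
    finally have "norm (T n a - a) \<le> K * norm (a - r) + norm (T n r - r)"
      by (simp add: K_def algebra_simps)
    also have "\<dots> < \<epsilon> / 2 + \<epsilon> / 2"
      using r(2) n0[OF that] K by (intro add_strict_mono) (simp_all add: field_simps)
    finally show ?thesis by simp
  qed
  then show "\<exists>n0. \<forall>n\<ge>n0. norm (T n a - a) < \<epsilon>" by blast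
qed

section \<open>The search for an approximate unit\<close>

text \<open>The search runs over all numbers \<open>w\<close>. The symmetrization \<open>h = x + star x\<close> of the point \<open>x\<close> given by
\<open>sanitize N w\<close> is self-adjoint, and \<open>h\<^sup>2\<close> is the candidate for a member of the approximate unit.\<close>

definition symmetric_code :: "enat \<Rightarrow> nat \<Rightarrow> nat" where
  "symmetric_code N w = append_code (sanitize N w) (star_code (sanitize N w))"

lemma recursive_symmetric_code [rec_intros]:
  "recursive n F \<Longrightarrow> recursive n (\<lambda>xs. symmetric_code N (F xs))"
  unfolding symmetric_code_def by (intro rec_intros)

definition square_code :: "enat \<Rightarrow> nat \<Rightarrow> nat" where
  "square_code N w = mult_code (symmetric_code N w) (symmetric_code N w)"

lemma recursive_square_code [rec_intros]:
  "recursive n F \<Longrightarrow> recursive n (\<lambda>xs. square_code N (F xs))"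
  unfolding square_code_def by (intro rec_intros)

definition left_defect_code :: "enat \<Rightarrow> nat \<Rightarrow> nat \<Rightarrow> nat" where
  "left_defect_code N w e =
    append_code (mult_code (square_code N w) (sanitize N e)) (neg_code (sanitize N e))"

lemma recursive_left_defect_code [rec_intros]:
  "recursive n F \<Longrightarrow> recursive n G \<Longrightarrow> recursive n (\<lambda>xs. left_defect_code N (F xs) (G xs))"
  unfolding left_defect_code_def by (intro rec_intros)

definition right_defect_code :: "enat \<Rightarrow> nat \<Rightarrow> nat \<Rightarrow> nat" where
  "right_defect_code N w e =
    append_code (mult_code (sanitize N e) (square_code N w)) (neg_code (sanitize N e))"

lemma recursive_right_defect_code [rec_intros]:
  "recursive n F \<Longrightarrow> recursive n G \<Longrightarrow> recursive n (\<lambda>xs. right_defect_code N (F xs) (G xs))"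
  unfolding right_defect_code_def by (intro rec_intros)

text \<open>The value is 0 exactly if, for \<open>N\<close> the number of special points and according to the approximate norms
supplied by \<open>f\<close>, the candidate \<open>w\<close> has \<open>norm h < 4\<close> and moves the points with number at most \<open>n\<close>
by less than \<open>1 / 2 ^ Suc n\<close>. With precision \<open>n + 2\<close> the true displacement is below \<open>1 / 2 ^ n\<close> then, and
a true displacement below \<open>1 / 2 ^ (n + 2)\<close> is always recognised.\<close>

definition search_defect :: "(nat list \<Rightarrow> nat) \<Rightarrow> enat \<Rightarrow> nat \<Rightarrow> nat \<Rightarrow> nat" where
  "search_defect f N n w = exceeds (f [symmetric_code N w, 0]) 1 4 +
     (\<Sum>e<Suc n. exceeds (f [left_defect_code N w e, n + 2]) (2 ^ Suc n) 1 +
                 exceeds (f [right_defect_code N w e, n + 2]) (2 ^ Suc n) 1)"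

lemma recursive_search_defect:
  assumes f: "recursive 2 f"
  shows "recursive 2 (\<lambda>xs. search_defect f N (xs ! 1) (xs ! 0))"
  unfolding search_defect_def
proof (intro recursive_add recursive_sum)
  show "recursive 2 (\<lambda>xs. exceeds (f [symmetric_code N (xs ! 0), 0]) 1 4)"
    by (intro rec_intros recursive_comp_binary[OF f]) simp
  show "recursive (2 + 2) (\<lambda>ys. exceeds (f [left_defect_code N (drop 2 ys ! 0) (ys ! 0), drop 2 ys ! 1 + 2]) (2 ^ Suc (drop 2 ys ! 1)) 1)"
    by (intro rec_intros recursive_comp_binary[OF f]) simp_all
  show "recursive (2 + 2) (\<lambda>ys. exceeds (f [right_defect_code N (drop 2 ys ! 0) (ys ! 0), drop 2 ys ! 1 + 2]) (2 ^ Suc (drop 2 ys ! 1)) 1)"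
    by (intro rec_intros recursive_comp_binary[OF f]) simp_all
  show "recursive 2 (\<lambda>xs. Suc (xs ! 1))" by (intro rec_intros) simp
qed
lemma good_defect_codes:
  "good_code N (symmetric_code N w)" "good_code N (square_code N w)"
  "good_code N (left_defect_code N w e)" "good_code N (right_defect_code N w e)"
  by (simp_all add: symmetric_code_def square_code_def left_defect_code_def right_defect_code_def
      good_append_code good_mult_code good_neg_code good_star_code good_sanitize)

lemma code_value_defect_codes:
  fixes a :: "nat \<Rightarrow> 'a::cstar_algebra" and N :: enat
  defines "h \<equiv> \<lambda>w. code_value a (sanitize N w) + star (code_value a (sanitize N w))"
  shows "code_value a (symmetric_code N w) = h w"
    and "code_value a (square_code N w) = h w * h w"
    and "code_value a (left_defect_code N w e) =
      h w * h w * code_value a (sanitize N e) - code_value a (sanitize N e)"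
    and "code_value a (right_defect_code N w e) =
      code_value a (sanitize N e) * (h w * h w) - code_value a (sanitize N e)"
proof -
  show s: "code_value a (symmetric_code N w) = h w"
    by (simp add: symmetric_code_def h_def code_value_append_code code_value_star_code)
  show q: "code_value a (square_code N w) = h w * h w"
    using code_value_mult_code[OF good_defect_codes(1) good_defect_codes(1), of a N w w]
    by (simp add: square_code_def s)
  show "code_value a (left_defect_code N w e) =
      h w * h w * code_value a (sanitize N e) - code_value a (sanitize N e)"
    using code_value_mult_code[OF good_defect_codes(2) good_sanitize, of a N w e]
    by (simp add: left_defect_code_def code_value_append_code code_value_neg_code q)
  show "code_value a (right_defect_code N w e) =
      code_value a (sanitize N e) * (h w * h w) - code_value a (sanitize N e)"
    using code_value_mult_code[OF good_sanitize good_defect_codes(2), of a N e w]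
    by (simp add: right_defect_code_def code_value_append_code code_value_neg_code q)
qed

definition approximates_norm ::
    "'a::cstar_algebra presentation \<Rightarrow> (nat list \<Rightarrow> nat) \<Rightarrow> bool" where
  "approximates_norm P f \<longleftrightarrow> (\<forall>e k. is_code P e \<longrightarrow>
     \<bar>norm (generated_point P e) - rat_value (f [e, k])\<bar> < 1 / 2 ^ k)"

lemma norm_less_if_not_exceeds:
  assumes f: "approximates_norm P f" and e: "good_code (num_special P) e"
    and z: "exceeds (f [e, k]) x y = 0" and xy: "x > 0" "y > 0"
  shows "norm (generated_point P e) < real y / real x + 1 / 2 ^ k"
proof -
  have "\<bar>norm (generated_point P e) - rat_value (f [e, k])\<bar> < 1 / 2 ^ k"
    using f is_code_if_good[OF e] by (simp add: approximates_norm_def)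
  with z show ?thesis unfolding exceeds_eq_0_iff[OF xy] by linarith
qed

lemma not_exceeds_if_norm_le:
  assumes f: "approximates_norm P f" and e: "good_code (num_special P) e"
    and le: "norm (generated_point P e) + 1 / 2 ^ k \<le> real y / real x" and xy: "x > 0" "y > 0"
  shows "exceeds (f [e, k]) x y = 0"
proof -
  have "\<bar>norm (generated_point P e) - rat_value (f [e, k])\<bar> < 1 / 2 ^ k"
    using f is_code_if_good[OF e] by (simp add: approximates_norm_def)
  with le show ?thesis
    using norm_ge_zero[of "generated_point P e"] unfolding exceeds_eq_0_iff[OF xy] by linarith
qed

definition sanitized_point :: "'a::cstar_algebra presentation \<Rightarrow> nat \<Rightarrow> 'a" where
  "sanitized_point P e = generated_point P (sanitize (num_special P) e)"

definition symmetric_point :: "'a::cstar_algebra presentation \<Rightarrow> nat \<Rightarrow> 'a" where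
  "symmetric_point P w = sanitized_point P w + star (sanitized_point P w)"

lemma sanitized_point_eq: "is_code P e \<Longrightarrow> sanitized_point P e = generated_point P e"
  by (simp add: sanitized_point_def generated_point_sanitize)

lemma generated_point_search_codes:
  fixes P :: "'a::cstar_algebra presentation"
  defines "N \<equiv> num_special P" and "h \<equiv> symmetric_point P" and "r \<equiv> sanitized_point P"
  shows "generated_point P (symmetric_code N w) = h w"
    and "generated_point P (square_code N w) = h w * h w"
    and "generated_point P (left_defect_code N w e) = h w * h w * r e - r e"
    and "generated_point P (right_defect_code N w e) = r e * (h w * h w) - r e"
  using code_value_defect_codes[of "special P" N]
  by (simp_all add: generated_point_eq N_def h_def r_def symmetric_point_def sanitized_point_def)

lemma search_defect_sound:
  fixes P :: "'a::cstar_algebra presentation"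
  defines "N \<equiv> num_special P" and "h \<equiv> symmetric_point P" and "r \<equiv> sanitized_point P"
  assumes f: "approximates_norm P f" and s: "search_defect f N n w = 0"
  shows "norm (h w) < 5"
    and "e \<le> n \<Longrightarrow> norm (h w * h w * r e - r e) < 1 / 2 ^ n"
    and "e \<le> n \<Longrightarrow> norm (r e * (h w * h w) - r e) < 1 / 2 ^ n"
proof -
  note good = good_defect_codes[of "num_special P", folded N_def]
  note less = norm_less_if_not_exceeds[OF f, folded N_def]
  note gp = generated_point_search_codes[of P, folded N_def h_def r_def]
  have z: "exceeds (f [symmetric_code N w, 0]) 1 4 = 0"
    "\<And>e. e \<le> n \<Longrightarrow> exceeds (f [left_defect_code N w e, n + 2]) (2 ^ Suc n) 1 = 0"
    "\<And>e. e \<le> n \<Longrightarrow> exceeds (f [right_defect_code N w e, n + 2]) (2 ^ Suc n) 1 = 0"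
    using s unfolding search_defect_def add_is_0 sum_eq_0_iff[OF finite_lessThan] by auto
  have le: "real 1 / real (2 ^ Suc n) + 1 / 2 ^ (n + 2) \<le> 1 / 2 ^ n" by (simp add: field_simps)
  show "norm (h w) < 5" using less[OF good(1) z(1)] by (simp add: gp)
  show "norm (h w * h w * r e - r e) < 1 / 2 ^ n" if "e \<le> n"
    using less[OF good(3) z(2)[OF that]] le unfolding gp by simp
  show "norm (r e * (h w * h w) - r e) < 1 / 2 ^ n" if "e \<le> n"
    using less[OF good(4) z(3)[OF that]] le unfolding gp by simp
qed

text \<open>The element provided by \<open>self_adjoint_approximate_unit\<close> need not be a generated point, but the
  symmetrizations of generated points near one half of it converge to it. All conditions are open, so
  that one of these symmetrizations satisfies them; its norm is below 3 rather than at most 2.\<close>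

lemma search_defect_complete:
  fixes P :: "'a::cstar_algebra presentation"
  assumes P: "is_presentation P" and f: "approximates_norm P f"
  shows "\<exists>w. search_defect f (num_special P) n w = 0"
proof -
  define N h r where "N = num_special P" and "h = symmetric_point P" and "r = sanitized_point P"
  note good = good_defect_codes[of "num_special P", folded N_def]
  note not_exceeds = not_exceeds_if_norm_le[OF f, folded N_def]
  note gp = generated_point_search_codes[of P, folded N_def h_def r_def]
  define \<delta> :: real where "\<delta> = 1 / 2 ^ (n + 2)"
  obtain h0 where h0: "star h0 = h0" "norm h0 \<le> 2"
    "\<And>e. e \<le> n \<Longrightarrow> norm (h0 * h0 * r e - r e) < \<delta> \<and> norm (r e * (h0 * h0) - r e) < \<delta>"
    using self_adjoint_approximate_unit[of "r ` {..n}" \<delta>] by (auto simp: \<delta>_def)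
  have "(1 / 2) *\<^sub>R h0 \<in> closure {generated_point P e |e. good_code N e}"
    using good_codes_dense[OF P] by (simp add: N_def)
  then obtain g where g: "\<And>k. g k \<in> {generated_point P e |e. good_code N e}"
    "g \<longlonglongrightarrow> (1 / 2) *\<^sub>R h0" unfolding closure_sequential by blast
  from g(1) obtain c where c: "\<And>k. good_code N (c k)" "\<And>k. g k = generated_point P (c k)"
    by simp metis
  have rc: "r (c k) = g k" for k
    using c sanitized_point_eq[OF is_code_if_good, of P "c k"] by (simp add: r_def N_def)
  have "(\<lambda>k. g k + star (g k)) \<longlonglongrightarrow> (1 / 2) *\<^sub>R h0 + star ((1 / 2) *\<^sub>R h0)"
    by (intro tendsto_add tendsto_star g(2))
  moreover have "(1 / 2) *\<^sub>R h0 + star ((1 / 2) *\<^sub>R h0) = h0"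
    by (simp add: scaleR_scaleC star_scaleC h0(1) flip: scaleC_add_left)
  ultimately have hc: "(\<lambda>k. h (c k)) \<longlonglongrightarrow> h0"
    by (simp add: h_def symmetric_point_def rc flip: r_def)
  have "\<forall>\<^sub>F k in sequentially. norm (h (c k)) < 3"
    using tendsto_norm[OF hc] by (rule order_tendstoD) (use h0(2) in simp)
  moreover have "\<forall>\<^sub>F k in sequentially. \<forall>e\<in>{..n}.
      norm (h (c k) * h (c k) * r e - r e) < \<delta> \<and> norm (r e * (h (c k) * h (c k)) - r e) < \<delta>"
  proof (intro eventually_ball_finite ballI eventually_conj)
    fix e assume e: "e \<in> {..n}"
    have "(\<lambda>k. norm (h (c k) * h (c k) * r e - r e)) \<longlonglongrightarrow> norm (h0 * h0 * r e - r e)"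
      by (intro tendsto_intros hc)
    then show "\<forall>\<^sub>F k in sequentially. norm (h (c k) * h (c k) * r e - r e) < \<delta>"
      by (rule order_tendstoD) (use h0(3) e in simp)
    have "(\<lambda>k. norm (r e * (h (c k) * h (c k)) - r e)) \<longlonglongrightarrow> norm (r e * (h0 * h0) - r e)"
      by (intro tendsto_intros hc)
    then show "\<forall>\<^sub>F k in sequentially. norm (r e * (h (c k) * h (c k)) - r e) < \<delta>"
      by (rule order_tendstoD) (use h0(3) e in simp)
  qed simp
  ultimately have "\<forall>\<^sub>F k in sequentially. norm (h (c k)) < 3 \<and> (\<forall>e\<in>{..n}.
      norm (h (c k) * h (c k) * r e - r e) < \<delta> \<and> norm (r e * (h (c k) * h (c k)) - r e) < \<delta>)"
    by (rule eventually_conj)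
  from eventually_happens'[OF sequentially_bot this] obtain k where k: "norm (h (c k)) < 3"
    "\<And>e. e \<le> n \<Longrightarrow> norm (h (c k) * h (c k) * r e - r e) < \<delta>"
    "\<And>e. e \<le> n \<Longrightarrow> norm (r e * (h (c k) * h (c k)) - r e) < \<delta>"
    by blast
  have \<delta>2: "\<delta> + 1 / 2 ^ (n + 2) = real 1 / real (2 ^ Suc n)" by (simp add: \<delta>_def field_simps)
  have "exceeds (f [symmetric_code N (c k), 0]) 1 4 = 0"
    by (rule not_exceeds[OF good(1)]) (use k(1) in \<open>simp_all add: gp\<close>)
  moreover have "exceeds (f [left_defect_code N (c k) e, n + 2]) (2 ^ Suc n) 1 = 0" if "e \<le> n" for e
    by (rule not_exceeds[OF good(3)]) (use k(2)[OF that] \<delta>2 in \<open>simp_all only: gp, simp_all\<close>)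
  moreover have "exceeds (f [right_defect_code N (c k) e, n + 2]) (2 ^ Suc n) 1 = 0" if "e \<le> n" for e
    by (rule not_exceeds[OF good(4)]) (use k(3)[OF that] \<delta>2 in \<open>simp_all only: gp, simp_all\<close>)
  ultimately have "search_defect f N n (c k) = 0" by (simp add: search_defect_def del: power_Suc)
  then show ?thesis unfolding N_def by blast
qed

theorem theorem4p6:
  fixes P :: "'a::cstar_algebra presentation"
  assumes "separable_space (euclidean :: 'a topology)"
    and "\<nexists>e::'a. \<forall>x. e * x = x \<and> x * e = x"
    and "computable_presentation P"
  shows "\<exists>u. effective_approximate_unit P u"
proof -
  define N h r where "N = num_special P" and "h = symmetric_point P" and "r = sanitized_point P"
  have P: "is_presentation P" using assms(3) by (simp add: computable_presentation_def)
  obtain f where f: "recursive 2 f" "approximates_norm P f"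
    using assms(3) unfolding computable_presentation_def approximates_norm_def rat_value_def by blast
  have search: "\<exists>w. search_defect f N n w = 0" for n
    unfolding N_def by (rule search_defect_complete[OF P f(2)])
  define W where "W = (\<lambda>n. LEAST w. search_defect f N n w = 0)"
  have W: "search_defect f N n (W n) = 0" for n
    unfolding W_def using search by (rule LeastI_ex)
  have recW: "recursive 1 (\<lambda>xs. W (xs ! 0))"
  proof -
    have "recursive (Suc 1) (\<lambda>xs. search_defect f N (xs ! 1) (xs ! 0))"
      using recursive_search_defect[OF f(1)] by (simp add: numeral_2_eq_2)
    from recursive_Least[OF this] show ?thesis using search by (simp add: W_def)
  qed
  define u where "u = (\<lambda>n. h (W n) * h (W n))"
  have uc: "u n = generated_point P (square_code N (W n))" for n
    by (simp add: u_def h_def N_def generated_point_search_codes)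
  note sound = search_defect_sound[OF f(2), folded N_def h_def r_def, OF W]
  have ub: "norm (u n) \<le> 25" for n
  proof -
    have "norm (u n) \<le> norm (h (W n)) * norm (h (W n))" unfolding u_def by (rule norm_mult_ineq)
    also have "\<dots> \<le> 5 * 5" using sound(1)[of n] by (intro mult_mono) auto
    finally show ?thesis by simp
  qed
  have tail: "\<forall>n\<ge>e + k. norm (u n * r e - r e) < 1 / 2 ^ k \<and> norm (r e * u n - r e) < 1 / 2 ^ k" for e k
  proof (intro allI impI)
    fix n assume n: "e + k \<le> n"
    then have "1 / 2 ^ n \<le> (1 / 2 ^ k :: real)" by (simp add: field_simps)
    then show "norm (u n * r e - r e) < 1 / 2 ^ k \<and> norm (r e * u n - r e) < 1 / 2 ^ k"
      using sound(2,3)[of e n] n by (auto simp: u_def)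
  qed
  have lim: "(\<lambda>n. u n * r e) \<longlonglongrightarrow> r e" "(\<lambda>n. r e * u n) \<longlonglongrightarrow> r e" for e
  proof -
    have "\<exists>n0. \<forall>n\<ge>n0. norm (u n * r e - r e) < \<epsilon> \<and> norm (r e * u n - r e) < \<epsilon>"
      if \<epsilon>: "\<epsilon> > 0" for \<epsilon> :: real
    proof -
      obtain k where "1 / 2 ^ k < \<epsilon>"
        using real_arch_pow_inv[of \<epsilon> "1 / 2"] \<epsilon> by (auto simp: power_one_over)
      then show ?thesis using tail[of e k] by (intro exI[of _ "e + k"]) force
    qed
    then show "(\<lambda>n. u n * r e) \<longlonglongrightarrow> r e" "(\<lambda>n. r e * u n) \<longlonglongrightarrow> r e"
      unfolding LIMSEQ_iff by blast+
  qed
  have dense: "closure (range r) = UNIV"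
  proof -
    have "generated_point P e \<in> range r" if "good_code N e" for e
      using sanitized_point_eq[OF is_code_if_good, of P e] that by (metis N_def r_def rangeI)
    then have "closure {generated_point P e |e. good_code N e} \<subseteq> closure (range r)"
      by (intro closure_mono) blast
    then show ?thesis using good_codes_dense[OF P] by (auto simp: N_def)
  qed
  have "approximate_unit u"
    unfolding approximate_unit_def
  proof (intro conjI allI)
    fix n
    show "positive (u n)"
      unfolding u_def
      by (rule positive_square) (simp add: h_def symmetric_point_def star_add star_star add.commute)
  next
    fix a
    show "(\<lambda>n. u n * a) \<longlonglongrightarrow> a"
    proof (rule tendsto_identity_if_dense[OF _ _ dense, where C = 25])
      show "norm (u n * x) \<le> 25 * norm x" for n x
        using norm_mult_ineq[of "u n" x] mult_right_mono[OF ub[of n], of "norm x"] by simp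
    qed (use lim in \<open>auto simp: right_diff_distrib\<close>)
    show "(\<lambda>n. a * u n) \<longlonglongrightarrow> a"
    proof (rule tendsto_identity_if_dense[OF _ _ dense, where C = 25])
      show "norm (x * u n) \<le> 25 * norm x" for n x
        using norm_mult_ineq[of x "u n"] mult_left_mono[OF ub[of n], of "norm x"] by simp
    qed (use lim in \<open>auto simp: left_diff_distrib\<close>)
  qed
  moreover have "computable_sequence P u"
    unfolding computable_sequence_def
  proof (intro exI conjI allI)
    \<comment> \<open>The members of \<open>u\<close> are generated points, so that one code serves all precisions.\<close>
    show "recursive 2 (\<lambda>xs. square_code N (W (xs ! 0)))"
      by (intro rec_intros recursive_comp1[OF recW]) simp_all
    fix n k
    show "is_code P (square_code N (W ([n, k] ! 0)))"
      by (rule is_code_if_good) (use good_defect_codes in \<open>simp add: N_def\<close>)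
    show "norm (u n - generated_point P (square_code N (W ([n, k] ! 0)))) < 1 / 2 ^ k"
      by (simp add: uc)
  qed
  moreover have "recursive 2 (\<lambda>xs. xs ! 0 + xs ! 1)" by (intro rec_intros) simp_all
  moreover have "modulus_of_convergence (\<lambda>n. u n * generated_point P e) (\<lambda>k. [e, k] ! 0 + [e, k] ! 1)"
    "modulus_of_convergence (\<lambda>n. generated_point P e * u n) (\<lambda>k. [e, k] ! 0 + [e, k] ! 1)"
    if "is_code P e" for e
  proof -
    have "generated_point P e = r e" using sanitized_point_eq[OF that] by (simp add: r_def)
    then show "modulus_of_convergence (\<lambda>n. u n * generated_point P e) (\<lambda>k. [e, k] ! 0 + [e, k] ! 1)"
      "modulus_of_convergence (\<lambda>n. generated_point P e * u n) (\<lambda>k. [e, k] ! 0 + [e, k] ! 1)"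
      unfolding modulus_of_convergence_def using lim[of e] tail[of e] by auto
  qed
  ultimately show ?thesis unfolding effective_approximate_unit_def by blast
qed

end
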